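(* Let $n$ be a positive integer. Let $j_!$ and $j_*$ be the left and right adjoints of the functor $j^*$ from $\mathscr{A}_n$ to $\mathscr{P}_n$, $j^*(\mathbf f)(V)=\mathbf f(V^{\otimes n})$. The unit $Id_{\mathscr{P}_n}\to j^*j_!$ and the counit $j^*j_*\to Id_{\mathscr{P}_n}$ are isomorphisms.
   Context: $\mathbb{K}$ is a field of positive characteristic; $\mathscr{V}$ is the category of finite-dimensional $\mathbb{K}$-vector spaces, $W^\vee$ the dual of $W$; ${}_{\mathfrak{S}_n}\mathscr{V}$ is the category of finite-dimensional representations of the symmetric group $\mathfrak{S}_n$; $\mathscr{A}_n$ is the category of covariant $\mathbb{K}$-linear functors ${}_{\mathfrak{S}_n}\mathscr{V}\to\mathscr{V}$. $\Gamma^n\mathscr{V}$ is the category with the same objects as $\mathscr{V}$ and $\mathrm{Hom}_{\Gamma^n\mathscr{V}}(V,W)=(\mathrm{Hom}(V,W)^{\otimes n})^{\mathfrak{S}_n}\cong\mathrm{Hom}_{\mathfrak{S}_n}(V^{\otimes n},W^{\otimes n})$; $\mathscr{P}_n$ (homogeneous strict polynomial functors of degree $n$) is the category of $\mathbb{K}$-linear functors $\Gamma^n\mathscr{V}\to\mathscr{V}$. Explicitly, $j_*(F)(M)=\mathrm{Hom}_{\mathscr{P}_n}(\mathrm{Hom}_{\mathfrak{S}_n}(M,(-)^{\otimes n}),F)$ and $j_!(F)=\mathbb{D}(j_*(\mathbb{D}F))$, with dualities $(\mathbb{D}\mathbf f)(M)=\mathbf f(M^\vee)^\vee$ on $\mathscr{A}_n$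 and $(\mathbb{D}F)(V)=F(V^\vee)^\vee$ on $\mathscr{P}_n$. *)

theory Defs
  imports
    "HOL-Algebra.Sym_Groups"
    "HOL-Algebra.Group_Action"
    "Jordan_Normal_Form.Missing_VectorSpace"
begin

section \<open>Linear categories and functors\<close>

text \<open>
  The spaces of morphisms of a linear category are modules, as the locale \<open>module\<close> understands
  them. \<^term>\<open>Comp C X Y Z g f\<close> is the composite of \<open>f : X \<rightarrow> Y\<close> and \<open>g : Y \<rightarrow> Z\<close>; the objects are
  passed along because the morphisms of the categories below are extensional functions, which do
  not determine their source and target.
\<close>

record ('k, 'o, 'm) lin_cat =
  Obj :: "'o set"
  Hom :: "'o \<Rightarrow> 'o \<Rightarrow> ('k, 'm) module"
  Ident :: "'o \<Rightarrow> 'm"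
  Comp :: "'o \<Rightarrow> 'o \<Rightarrow> 'o \<Rightarrow> 'm \<Rightarrow> 'm \<Rightarrow> 'm"

record ('o1, 'm1, 'o2, 'm2) cfunctor =
  on_obj :: "'o1 \<Rightarrow> 'o2"
  on_mor :: "'o1 \<Rightarrow> 'o1 \<Rightarrow> 'm1 \<Rightarrow> 'm2"

definition is_functor ::
  "('k, 'o1, 'm1) lin_cat \<Rightarrow> ('k, 'o2, 'm2) lin_cat \<Rightarrow> ('o1, 'm1, 'o2, 'm2) cfunctor \<Rightarrow> bool"
  where "is_functor C D F \<longleftrightarrow>
    (\<forall>X \<in> Obj C. on_obj F X \<in> Obj D) \<and>
    (\<forall>X \<in> Obj C. \<forall>Y \<in> Obj C. \<forall>f \<in> carrier (Hom C X Y).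
      on_mor F X Y f \<in> carrier (Hom D (on_obj F X) (on_obj F Y))) \<and>
    (\<forall>X \<in> Obj C. on_mor F X X (Ident C X) = Ident D (on_obj F X)) \<and>
    (\<forall>X \<in> Obj C. \<forall>Y \<in> Obj C. \<forall>Z \<in> Obj C.
      \<forall>f \<in> carrier (Hom C X Y). \<forall>g \<in> carrier (Hom C Y Z).
        on_mor F X Z (Comp C X Y Z g f) =
        Comp D (on_obj F X) (on_obj F Y) (on_obj F Z) (on_mor F Y Z g) (on_mor F X Y f))"

definition linear_functor ::
  "'k ring \<Rightarrow> ('k, 'o1, 'm1) lin_cat \<Rightarrow> ('k, 'o2, 'm2) lin_cat \<Rightarrow>
    ('o1, 'm1, 'o2, 'm2) cfunctor \<Rightarrow> bool"
  where "linear_functor K C D F \<longleftrightarrow> is_functor C D F \<and>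
    (\<forall>X \<in> Obj C. \<forall>Y \<in> Obj C.
      on_mor F X Y \<in> module_hom K (Hom C X Y) (Hom D (on_obj F X) (on_obj F Y)))"

definition id_functor :: "('o, 'm, 'o, 'm) cfunctor"
  where "id_functor = \<lparr>on_obj = (\<lambda>X. X), on_mor = (\<lambda>X Y f. f)\<rparr>"

definition comp_functor ::
  "('o2, 'm2, 'o3, 'm3) cfunctor \<Rightarrow> ('o1, 'm1, 'o2, 'm2) cfunctor \<Rightarrow> ('o1, 'm1, 'o3, 'm3) cfunctor"
  where "comp_functor G F =
    \<lparr>on_obj = (\<lambda>X. on_obj G (on_obj F X)),
     on_mor = (\<lambda>X Y f. on_mor G (on_obj F X) (on_obj F Y) (on_mor F X Y f))\<rparr>"

definition nat_transf ::
  "('k, 'o1, 'm1) lin_cat \<Rightarrow> ('k, 'o2, 'm2) lin_cat \<Rightarrow>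
    ('o1, 'm1, 'o2, 'm2) cfunctor \<Rightarrow> ('o1, 'm1, 'o2, 'm2) cfunctor \<Rightarrow> ('o1 \<Rightarrow> 'm2) \<Rightarrow> bool"
  where "nat_transf C D F G \<alpha> \<longleftrightarrow>
    (\<forall>X \<in> Obj C. \<alpha> X \<in> carrier (Hom D (on_obj F X) (on_obj G X))) \<and>
    (\<forall>X \<in> Obj C. \<forall>Y \<in> Obj C. \<forall>f \<in> carrier (Hom C X Y).
      Comp D (on_obj F X) (on_obj F Y) (on_obj G Y) (\<alpha> Y) (on_mor F X Y f) =
      Comp D (on_obj F X) (on_obj G X) (on_obj G Y) (on_mor G X Y f) (\<alpha> X))"

definition is_iso :: "('k, 'o, 'm) lin_cat \<Rightarrow> 'o \<Rightarrow> 'o \<Rightarrow> 'm \<Rightarrow> bool"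
  where "is_iso C X Y f \<longleftrightarrow> f \<in> carrier (Hom C X Y) \<and>
    (\<exists>g \<in> carrier (Hom C Y X). Comp C X Y X g f = Ident C X \<and> Comp C Y X Y f g = Ident C Y)"

definition nat_iso ::
  "('k, 'o1, 'm1) lin_cat \<Rightarrow> ('k, 'o2, 'm2) lin_cat \<Rightarrow>
    ('o1, 'm1, 'o2, 'm2) cfunctor \<Rightarrow> ('o1, 'm1, 'o2, 'm2) cfunctor \<Rightarrow> ('o1 \<Rightarrow> 'm2) \<Rightarrow> bool"
  where "nat_iso C D F G \<alpha> \<longleftrightarrow> nat_transf C D F G \<alpha> \<and>
    (\<forall>X \<in> Obj C. is_iso D (on_obj F X) (on_obj G X) (\<alpha> X))"

text \<open>
  \<open>adjunction C D L R \<eta> \<epsilon>\<close>: the functor \<open>L : C \<rightarrow> D\<close> is left adjoint to \<open>R : D \<rightarrow> C\<close>, with unit \<open>\<eta>\<close>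
  and counit \<open>\<epsilon>\<close>.
\<close>

definition adjunction ::
  "('k, 'o1, 'm1) lin_cat \<Rightarrow> ('k, 'o2, 'm2) lin_cat \<Rightarrow>
    ('o1, 'm1, 'o2, 'm2) cfunctor \<Rightarrow> ('o2, 'm2, 'o1, 'm1) cfunctor \<Rightarrow>
    ('o1 \<Rightarrow> 'm1) \<Rightarrow> ('o2 \<Rightarrow> 'm2) \<Rightarrow> bool"
  where "adjunction C D L R \<eta> \<epsilon> \<longleftrightarrow>
    is_functor C D L \<and> is_functor D C R \<and>
    nat_transf C C id_functor (comp_functor R L) \<eta> \<and>
    nat_transf D D (comp_functor L R) id_functor \<epsilon> \<and>
    (\<forall>X \<in> Obj C. let LX = on_obj L X; RLX = on_obj R LX; LRLX = on_obj L RLX in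
      Comp D LX LRLX LX (\<epsilon> LX) (on_mor L X RLX (\<eta> X)) = Ident D LX) \<and>
    (\<forall>Y \<in> Obj D. let RY = on_obj R Y; LRY = on_obj L RY; RLRY = on_obj R LRY in
      Comp C RY RLRY RY (on_mor R LRY Y (\<epsilon> Y)) (\<eta> RY) = Ident C RY)"

text \<open>
  The category of linear functors from \<open>C\<close> to \<open>D\<close>. A functor may take arbitrary values outside the
  objects and morphisms of \<open>C\<close>; functors that differ only there are distinct but isomorphic.
  As everywhere below, the ring multiplication that a record of type \<^typ>\<open>('a, 'b) module\<close> carries
  along is irrelevant.
\<close>

definition functor_cat ::
  "'k ring \<Rightarrow> ('k, 'o1, 'm1) lin_cat \<Rightarrow> ('k, 'o2, 'm2) lin_cat \<Rightarrow>
    ('k, ('o1, 'm1, 'o2, 'm2) cfunctor, 'o1 \<Rightarrow> 'm2) lin_cat"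
  where "functor_cat K C D =
    \<lparr>Obj = {F. linear_functor K C D F},
     Hom = (\<lambda>F G.
       \<lparr>carrier = {\<alpha> \<in> extensional (Obj C). nat_transf C D F G \<alpha>},
        mult = (\<lambda>\<alpha> \<beta>. \<lambda>X \<in> Obj C. \<zero>\<^bsub>Hom D (on_obj F X) (on_obj G X)\<^esub>),
        one = (\<lambda>X \<in> Obj C. \<zero>\<^bsub>Hom D (on_obj F X) (on_obj G X)\<^esub>),
        zero = (\<lambda>X \<in> Obj C. \<zero>\<^bsub>Hom D (on_obj F X) (on_obj G X)\<^esub>),
        add = (\<lambda>\<alpha> \<beta>. \<lambda>X \<in> Obj C. \<alpha> X \<oplus>\<^bsub>Hom D (on_obj F X) (on_obj G X)\<^esub> \<beta> X),
        smult = (\<lambda>a \<alpha>. \<lambda>X \<in> Obj C. a \<odot>\<^bsub>Hom D (on_obj F X) (on_obj G X)\<^esub> \<alpha> X)\<rparr>),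
     Ident = (\<lambda>F. \<lambda>X \<in> Obj C. Ident D (on_obj F X)),
     Comp = (\<lambda>F G H \<beta> \<alpha>. \<lambda>X \<in> Obj C.
       Comp D (on_obj F X) (on_obj G X) (on_obj H X) (\<beta> X) (\<alpha> X))\<rparr>"

text \<open>Precomposition with a functor \<open>j\<close> from \<open>B\<close>, as a functor between functor categories.\<close>

definition precomp ::
  "('k, 'o0, 'm0) lin_cat \<Rightarrow> ('o0, 'm0, 'o1, 'm1) cfunctor \<Rightarrow>
    (('o1, 'm1, 'o2, 'm2) cfunctor, 'o1 \<Rightarrow> 'm2, ('o0, 'm0, 'o2, 'm2) cfunctor, 'o0 \<Rightarrow> 'm2) cfunctor"
  where "precomp B j =
    \<lparr>on_obj = (\<lambda>F. comp_functor F j),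
     on_mor = (\<lambda>F G \<alpha>. \<lambda>X \<in> Obj B. \<alpha> (on_obj j X))\<rparr>"

section \<open>Vector spaces and representations of symmetric groups\<close>

text \<open>
  Linear maps are represented by extensional functions, so that two of them are equal as soon as
  they agree on the source.
\<close>

definition lin_maps ::
  "'k ring \<Rightarrow> ('k, 'a) module \<Rightarrow> ('k, 'b) module \<Rightarrow> ('k, 'a \<Rightarrow> 'b) module"
  where "lin_maps K V W =
    \<lparr>carrier = module_hom K V W \<inter> extensional (carrier V),
     mult = (\<lambda>f g. \<lambda>x \<in> carrier V. \<zero>\<^bsub>W\<^esub>),
     one = (\<lambda>x \<in> carrier V. \<zero>\<^bsub>W\<^esub>),
     zero = (\<lambda>x \<in> carrier V. \<zero>\<^bsub>W\<^esub>),
     add = (\<lambda>f g. \<lambda>x \<in> carrier V. f x \<oplus>\<^bsub>W\<^esub> g x),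
     smult = (\<lambda>a f. \<lambda>x \<in> carrier V. a \<odot>\<^bsub>W\<^esub> f x)\<rparr>"

text \<open>
  The finite-dimensional \<open>K\<close>-vector spaces whose elements are taken from the type \<open>'v\<close>. As soon
  as the finite lists over \<open>K\<close> embed into \<open>'v\<close>, every finite-dimensional \<open>K\<close>-vector space is
  isomorphic to one of these.
\<close>

definition Vect :: "'k ring \<Rightarrow> ('k, ('k, 'v) module, 'v \<Rightarrow> 'v) lin_cat"
  where "Vect K =
    \<lparr>Obj = {V. vectorspace K V \<and> vectorspace.fin_dim K V},
     Hom = lin_maps K,
     Ident = (\<lambda>V. \<lambda>x \<in> carrier V. x),
     Comp = (\<lambda>U V W g f. compose (carrier U) g f)\<rparr>"

type_synonym ('k, 'v) rep = "('k, 'v) module \<times> ((nat \<Rightarrow> nat) \<Rightarrow> 'v \<Rightarrow> 'v)"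

definition Rep :: "'k ring \<Rightarrow> nat \<Rightarrow> ('k, ('k, 'v) rep, 'v \<Rightarrow> 'v) lin_cat"
  where "Rep K n =
    \<lparr>Obj = {(V, \<rho>). V \<in> Obj (Vect K) \<and> group_action (sym_group n) (carrier V) \<rho> \<and>
       (\<forall>\<sigma> \<in> carrier (sym_group n). \<rho> \<sigma> \<in> module_hom K V V)},
     Hom = (\<lambda>(V, \<rho>) (W, \<theta>). (lin_maps K V W)
       \<lparr>carrier := {f \<in> carrier (lin_maps K V W).
          \<forall>\<sigma> \<in> carrier (sym_group n). \<forall>x \<in> carrier V. f (\<rho> \<sigma> x) = \<theta> \<sigma> (f x)}\<rparr>),
     Ident = (\<lambda>(V, \<rho>). \<lambda>x \<in> carrier V. x),
     Comp = (\<lambda>(U, \<pi>) (V, \<rho>) (W, \<theta>) g f. compose (carrier U) g f)\<rparr>"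

section \<open>Tensor powers\<close>

definition multilinear ::
  "'k ring \<Rightarrow> nat \<Rightarrow> ('k, 'a) module \<Rightarrow> ('k, 'b) module \<Rightarrow> ((nat \<Rightarrow> 'a) \<Rightarrow> 'b) \<Rightarrow> bool"
  where "multilinear K n V W m \<longleftrightarrow>
    (\<forall>x \<in> {1..n} \<rightarrow>\<^sub>E carrier V. m x \<in> carrier W \<and>
      (\<forall>i \<in> {1..n}. (\<lambda>v. m (x(i := v))) \<in> module_hom K V W))"

text \<open>
  \<open>T\<close>, together with \<open>\<tau>\<close>, which sends \<open>(x\<^sub>1, \<dots>, x\<^sub>n)\<close> to \<open>x\<^sub>1 \<otimes> \<dots> \<otimes> x\<^sub>n\<close>, is an \<open>n\<close>-th tensor power
  of \<open>V\<close>, on which the symmetric group acts by permuting the factors.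
\<close>

definition tensor_power ::
  "'k ring \<Rightarrow> nat \<Rightarrow> ('k, 'v) module \<Rightarrow> ('k, 'v) rep \<Rightarrow> ((nat \<Rightarrow> 'v) \<Rightarrow> 'v) \<Rightarrow> bool"
  where "tensor_power K n V T \<tau> \<longleftrightarrow>
    T \<in> Obj (Rep K n) \<and>
    multilinear K n V (fst T) \<tau> \<and>
    (\<forall>W \<in> Obj (Vect K). \<forall>m. multilinear K n V W m \<longrightarrow>
      (\<exists>!f. f \<in> carrier (Hom (Vect K) (fst T) W) \<and>
        (\<forall>x \<in> {1..n} \<rightarrow>\<^sub>E carrier V. f (\<tau> x) = m x))) \<and>
    (\<forall>\<sigma> \<in> carrier (sym_group n). \<forall>x \<in> {1..n} \<rightarrow>\<^sub>E carrier V.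
      snd T \<sigma> (\<tau> x) = \<tau> (x \<circ> inv\<^bsub>sym_group n\<^esub> \<sigma>))"

section \<open>Strict polynomial functors\<close>

text \<open>
  From here on, \<open>T\<close> chooses an \<open>n\<close>-th tensor power of every object of \<^term>\<open>Vect K\<close>.
  \<open>Gamma K n T\<close> has the vector spaces as objects; its morphisms, the \<open>n\<close>-th divided power
  \<open>(Hom(V, W)\<^sup>\<otimes>\<^sup>n)\<^sup>S\<^sup>n\<close>, are taken in the form \<open>Hom\<close> of representations from \<open>V\<^sup>\<otimes>\<^sup>n\<close> to \<open>W\<^sup>\<otimes>\<^sup>n\<close>, and are
  composed as such.
\<close>

definition Gamma ::
  "'k ring \<Rightarrow> nat \<Rightarrow> (('k, 'v) module \<Rightarrow> ('k, 'v) rep) \<Rightarrow> ('k, ('k, 'v) module, 'v \<Rightarrow> 'v) lin_cat"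
  where "Gamma K n T =
    \<lparr>Obj = Obj (Vect K),
     Hom = (\<lambda>V W. Hom (Rep K n) (T V) (T W)),
     Ident = (\<lambda>V. Ident (Rep K n) (T V)),
     Comp = (\<lambda>U V W. Comp (Rep K n) (T U) (T V) (T W))\<rparr>"

definition tensor_functor ::
  "(('k, 'v) module \<Rightarrow> ('k, 'v) rep) \<Rightarrow> (('k, 'v) module, 'v \<Rightarrow> 'v, ('k, 'v) rep, 'v \<Rightarrow> 'v) cfunctor"
  where "tensor_functor T = \<lparr>on_obj = T, on_mor = (\<lambda>V W h. h)\<rparr>"

abbreviation A_cat ::
  "'k ring \<Rightarrow> nat \<Rightarrow>
    ('k, (('k, 'v) rep, 'v \<Rightarrow> 'v, ('k, 'v) module, 'v \<Rightarrow> 'v) cfunctor, ('k, 'v) rep \<Rightarrow> 'v \<Rightarrow> 'v) lin_cat"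
  where "A_cat K n \<equiv> functor_cat K (Rep K n) (Vect K)"

abbreviation P_cat ::
  "'k ring \<Rightarrow> nat \<Rightarrow> (('k, 'v) module \<Rightarrow> ('k, 'v) rep) \<Rightarrow>
    ('k, (('k, 'v) module, 'v \<Rightarrow> 'v, ('k, 'v) module, 'v \<Rightarrow> 'v) cfunctor,
      ('k, 'v) module \<Rightarrow> 'v \<Rightarrow> 'v) lin_cat"
  where "P_cat K n T \<equiv> functor_cat K (Gamma K n T) (Vect K)"

definition j_pullback ::
  "'k ring \<Rightarrow> nat \<Rightarrow> (('k, 'v) module \<Rightarrow> ('k, 'v) rep) \<Rightarrow>
    ((('k, 'v) rep, 'v \<Rightarrow> 'v, ('k, 'v) module, 'v \<Rightarrow> 'v) cfunctor, ('k, 'v) rep \<Rightarrow> 'v \<Rightarrow> 'v,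
     (('k, 'v) module, 'v \<Rightarrow> 'v, ('k, 'v) module, 'v \<Rightarrow> 'v) cfunctor,
     ('k, 'v) module \<Rightarrow> 'v \<Rightarrow> 'v) cfunctor"
  where "j_pullback K n T = precomp (Gamma K n T) (tensor_functor T)"

end

theory Submission
  imports Defs
begin

text \<open>
  The functor \<open>j\<close> is a full embedding of \<open>\<Gamma>\<^sup>n\<V>\<close> into the representations of the symmetric group, and the
  adjoints of the restriction along a full embedding are Kan extensions that do not change the
  values on the subcategory. For the counit \<open>\<epsilon> : j\<^sup>*G \<rightarrow> F\<close> with \<open>G = j\<^sub>*F\<close>, the elements of
  \<open>G(jV)\<close> are the natural transformations from \<open>Hom(jV, -)\<close> to \<open>G\<close>, hence by adjunction those from
  \<open>Hom(V, -)\<close> to \<open>F\<close>, hence the elements of \<open>F(V)\<close>. For the unit \<open>\<eta> : F \<rightarrow> j\<^sup>*G\<close> with \<open>G = j\<^sub>!F\<close>,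
  natural transformations from \<open>G\<close> to \<open>Lin(Hom(-, jV), E)\<close> correspond to linear maps \<open>G(jV) \<rightarrow> E\<close>. With
  \<open>E = F(V)\<close> the identity of \<open>F(V)\<close> extends to \<open>p : G(jV) \<rightarrow> F(V)\<close> such that \<open>p \<circ> \<eta> = id\<close>; with
  \<open>E = G(jV)\<close> the transformations given by \<open>id\<close> and by \<open>\<eta> \<circ> p\<close> agree after composition with \<open>\<eta>\<close>, so
  \<open>\<eta> \<circ> p = id\<close>. As the values of functors must be spaces over the type \<open>'v\<close>, the spaces of
  morphisms are first transported there, by coordinates with respect to finite generating sets.
\<close>

section \<open>Finite-dimensional vector spaces\<close>

text \<open>The span of \<open>A\<close> is the least submodule containing \<open>A\<close>.
  Generation in this form is checked by closure arguments alone, without handling linear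
  combinations.\<close>

lemma fin_dim_iff_submodule:
  assumes "vectorspace K V"
  shows "vectorspace.fin_dim K V \<longleftrightarrow>
    (\<exists>A. finite A \<and> A \<subseteq> carrier V \<and> (\<forall>N. submodule K N V \<longrightarrow> A \<subseteq> N \<longrightarrow> N = carrier V))"
proof -
  interpret vectorspace K V by fact
  show ?thesis
    unfolding fin_dim_def
  proof (intro ex_cong1 conj_cong refl)
    fix A assume A: "A \<subseteq> carrier V"
    show "gen_set A \<longleftrightarrow> (\<forall>N. submodule K N V \<longrightarrow> A \<subseteq> N \<longrightarrow> N = carrier V)"
      using span_is_submodule[OF A] in_own_span[OF A] span_is_subset[of A] submodule.subset
      by (metis subset_antisym)
  qed
qed

lemma fin_dimE:
  assumes "vectorspace K V" "vectorspace.fin_dim K V"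
  obtains A where "finite A" "A \<subseteq> carrier V"
    "\<And>N. submodule K N V \<Longrightarrow> A \<subseteq> N \<Longrightarrow> N = carrier V"
proof -
  obtain A where "finite A \<and> A \<subseteq> carrier V \<and>
      (\<forall>N. submodule K N V \<longrightarrow> A \<subseteq> N \<longrightarrow> N = carrier V)"
    using iffD1[OF fin_dim_iff_submodule[OF assms(1)] assms(2)] by (elim exE)
  then show ?thesis
    using that[of A] by simp
qed

lemma module_hom_subset:
  assumes "f \<in> module_hom K V W" "U \<subseteq> carrier V"
  shows "f \<in> module_hom K (V\<lparr>carrier := U\<rparr>) W"
  using assms by (simp add: module_hom_def Pi_iff subset_iff)

lemma subspace_vectorspace:
  assumes "vectorspace K V" "submodule K U V"
  shows "vectorspace K (V\<lparr>carrier := U\<rparr>)"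
  using assms vectorspace.subspace_is_vs subspace.intro by blast

text \<open>Independent subsets of \<open>U\<close> stay independent in \<open>V\<close>, so the
  dimension of \<open>V\<close> bounds their size. Hence a maximal one exists, and it is a basis of
  \<open>U\<close>.\<close>

lemma subspace_fin_dim:
  assumes V: "vectorspace K V" "vectorspace.fin_dim K V" and U: "submodule K U V"
  shows "vectorspace.fin_dim K (V\<lparr>carrier := U\<rparr>)"
proof -
  interpret V: vectorspace K V by fact
  interpret U: vectorspace K "V\<lparr>carrier := U\<rparr>"
    by (rule subspace_vectorspace[OF V(1) U])
  have UV: "U \<subseteq> carrier V"
    using U by (rule submodule.subset)
  have *: "finite S \<and> card S \<le> V.dim"
    if "S \<subseteq> carrier (V\<lparr>carrier := U\<rparr>) \<and> U.lin_indpt S" for S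
    using that V.li_le_dim[OF V(2), of S] V.span_li_not_depend(2)[OF _ U, of S] UV by auto
  have "U.lin_indpt {}"
    unfolding U.lin_dep_def by auto
  then obtain A where "finite A" "maximal A (\<lambda>S. S \<subseteq> carrier (V\<lparr>carrier := U\<rparr>) \<and> U.lin_indpt S)"
    using maximal_exists[of "\<lambda>S. S \<subseteq> carrier (V\<lparr>carrier := U\<rparr>) \<and> U.lin_indpt S" V.dim "{}"] *
    by auto
  then show ?thesis
    using U.max_li_is_basis unfolding U.fin_dim_def U.basis_def by blast
qed

lemma linear_mapI:
  assumes "vectorspace K V" "vectorspace K W" "f \<in> module_hom K V W"
  shows "linear_map K V W f"
  using assms unfolding linear_map_def mod_hom_def mod_hom_axioms_def vectorspace_def by blast

text \<open>Generators of the kernel, together with preimages of generators of the image, generate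
  \<open>U\<close>. The image is finite-dimensional as a subspace of \<open>W\<close>.\<close>

lemma fin_dim_of_kernel:
  assumes U: "vectorspace K U" and W: "vectorspace K W" "vectorspace.fin_dim K W"
    and f: "f \<in> module_hom K U W"
    and ker: "vectorspace.fin_dim K (U\<lparr>carrier := {x \<in> carrier U. f x = \<zero>\<^bsub>W\<^esub>}\<rparr>)"
  shows "vectorspace.fin_dim K U"
proof -
  interpret f: linear_map K U W f
    by (rule linear_mapI[OF U W(1) f])
  let ?ker = "{x \<in> carrier U. f x = \<zero>\<^bsub>W\<^esub>}"
  have mU: "module K U" and mW: "module K W"
    using U W(1) unfolding vectorspace_def by auto
  have sker: "submodule K ?ker U"
    using f.ker_is_submodule unfolding f.ker_def .
  have sim: "submodule K (f ` carrier U) W"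
    using f.im_is_submodule unfolding f.im_def .
  obtain B where B: "finite B" "B \<subseteq> ?ker"
    "\<And>N. submodule K N (U\<lparr>carrier := ?ker\<rparr>) \<Longrightarrow> B \<subseteq> N \<Longrightarrow> N = ?ker"
    using fin_dimE[OF subspace_vectorspace[OF U sker] ker] by auto
  obtain C where C: "finite C" "C \<subseteq> f ` carrier U"
    "\<And>N. submodule K N (W\<lparr>carrier := f ` carrier U\<rparr>) \<Longrightarrow> C \<subseteq> N \<Longrightarrow> N = f ` carrier U"
    using fin_dimE[OF subspace_vectorspace[OF W(1) sim] subspace_fin_dim[OF W sim]] by auto
  obtain D where D: "finite D" "D \<subseteq> carrier U" "C = f ` D"
    using C(1,2) finite_subset_image by metis
  have "N = carrier U" if N: "submodule K N U" "B \<union> D \<subseteq> N" for N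
  proof -
    interpret N: submodule K N U by fact
    have NU: "N \<subseteq> carrier U" by (rule N.subset)
    \<comment> \<open>\<open>B\<close> generates the kernel as a space of its own, so
      \<open>N\<close> has to be cut down to a submodule of that space before \<open>B(3)\<close>
      applies.\<close>
    have "submodule K (N \<inter> ?ker) (U\<lparr>carrier := ?ker\<rparr>)"
      using module.submodule_is_module[OF mU sker] sker
      unfolding submodule_def by (auto simp: submodule.m_closed submodule.smult_closed)
    then have "N \<inter> ?ker = ?ker"
      using B(2) N(2) by (intro B(3)) auto
    then have kN: "?ker \<subseteq> N"
      by blast
    have "f \<in> module_hom K (U\<lparr>carrier := N\<rparr>) W"
      by (rule module_hom_subset[OF f NU])
    then have mh: "mod_hom K (U\<lparr>carrier := N\<rparr>) W f"
      using module.submodule_is_module[OF mU N(1)] mW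
      by (intro mod_hom.intro mod_hom_axioms.intro)
    have "submodule K (f ` N) W"
      using mod_hom.im_is_submodule[OF mh] mod_hom.im_def[OF mh] by simp
    then have "submodule K (f ` N) (W\<lparr>carrier := f ` carrier U\<rparr>)"
      using module.submodule_is_module[OF mW sim] NU unfolding submodule_def by auto
    then have fN: "f ` N = f ` carrier U"
      using D(3) N(2) by (intro C(3)) auto
    \<comment> \<open>Some \<open>y\<close> in \<open>N\<close> has the same image as
      \<open>x\<close>; the difference lies in the kernel, hence in \<open>N\<close>, and adding
      \<open>y\<close> back gives \<open>x\<close>.\<close>
    have "x \<in> N" if x: "x \<in> carrier U" for x
    proof -
      obtain y where y: "y \<in> N" "f x = f y"
        using fN x by (metis imageE imageI)
      have yU: "y \<in> carrier U" using y NU by blast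
      have "x \<ominus>\<^bsub>U\<^esub> y \<in> ?ker"
        using x yU y(2) by (simp add: a_minus_def abelian_group.r_neg[OF module.axioms(2)[OF mW]])
      then have "(x \<ominus>\<^bsub>U\<^esub> y) \<oplus>\<^bsub>U\<^esub> y \<in> N"
        using kN y(1) N.m_closed by blast
      then show ?thesis
        using x yU module.axioms(2)[OF mU]
        by (simp add: a_minus_def abelian_group.l_neg
          abelian_group.a_inv_closed abelian_monoid.a_assoc abelian_group.axioms(1))
    qed
    then show ?thesis using NU by blast
  qed
  moreover have "finite (B \<union> D)" "B \<union> D \<subseteq> carrier U"
    using B D by auto
  ultimately show ?thesis
    using fin_dim_iff_submodule[OF U] by blast
qed

text \<open>Induction on the family, with \<open>U\<close> varying: on the kernel of
  \<open>c a\<close> the remaining maps still separate points, and \<open>fin_dim_of_kernel\<close>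
  lifts finite dimension from this kernel to \<open>U\<close>. An empty family separates points only
  of the zero space.\<close>

lemma fin_dim_of_separating_family:
  assumes "finite A" and W: "vectorspace K W" "vectorspace.fin_dim K W"
  shows "vectorspace K U \<Longrightarrow> (\<And>a. a \<in> A \<Longrightarrow> c a \<in> module_hom K U W) \<Longrightarrow>
    (\<And>x. x \<in> carrier U \<Longrightarrow> (\<And>a. a \<in> A \<Longrightarrow> c a x = \<zero>\<^bsub>W\<^esub>) \<Longrightarrow> x = \<zero>\<^bsub>U\<^esub>) \<Longrightarrow>
    vectorspace.fin_dim K U"
  using assms(1)
proof (induction A arbitrary: U rule: finite_induct)
  case empty
  then have "carrier U \<subseteq> {\<zero>\<^bsub>U\<^esub>}"
    by blast
  then have "N = carrier U" if "submodule K N U" for N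
    using submodule.zero_closed[OF that] submodule.subset[OF that] by blast
  then show ?case
    using fin_dim_iff_submodule[OF empty.prems(1)] by blast
next
  case (insert a A)
  let ?ker = "{x \<in> carrier U. c a x = \<zero>\<^bsub>W\<^esub>}"
  interpret f: linear_map K U W "c a"
    using insert.prems(1,2) W(1) by (intro linear_mapI) auto
  have sker: "submodule K ?ker U"
    using f.ker_is_submodule unfolding f.ker_def .
  have "vectorspace.fin_dim K (U\<lparr>carrier := ?ker\<rparr>)"
  proof (rule insert.IH[OF subspace_vectorspace[OF insert.prems(1) sker]])
    show "c b \<in> module_hom K (U\<lparr>carrier := ?ker\<rparr>) W" if "b \<in> A" for b
      using insert.prems(2)[of b] that unfolding module_hom_def by auto
    show "x = \<zero>\<^bsub>U\<lparr>carrier := ?ker\<rparr>\<^esub>"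
      if "x \<in> carrier (U\<lparr>carrier := ?ker\<rparr>)" "\<And>b. b \<in> A \<Longrightarrow> c b x = \<zero>\<^bsub>W\<^esub>" for x
      using insert.prems(3)[of x] that by auto
  qed
  then show ?case
    using fin_dim_of_kernel[OF insert.prems(1) W] insert.prems(2) by blast
qed

section \<open>Spaces of linear maps\<close>

lemma lin_maps_simps [simp]:
  "carrier (lin_maps K V W) = module_hom K V W \<inter> extensional (carrier V)"
  "\<zero>\<^bsub>lin_maps K V W\<^esub> = (\<lambda>x \<in> carrier V. \<zero>\<^bsub>W\<^esub>)"
  "f \<oplus>\<^bsub>lin_maps K V W\<^esub> g = (\<lambda>x \<in> carrier V. f x \<oplus>\<^bsub>W\<^esub> g x)"
  "a \<odot>\<^bsub>lin_maps K V W\<^esub> f = (\<lambda>x \<in> carrier V. a \<odot>\<^bsub>W\<^esub> f x)"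
  by (simp_all add: lin_maps_def)

text \<open>Morphisms are extensional, so pointwise constructions get cut off outside the carrier.
  Linearity survives because the carrier is closed under the operations.\<close>

lemma module_hom_restrict:
  assumes "module K V"
  shows "restrict f (carrier V) \<in> module_hom K V W \<longleftrightarrow> f \<in> module_hom K V W"
proof -
  interpret module K V by fact
  show ?thesis
    unfolding module_hom_def by (auto simp: Pi_iff)
qed

lemma vectorspace_lin_maps:
  assumes "vectorspace K V" "vectorspace K W"
  shows "vectorspace K (lin_maps K V W)"
proof -
  interpret V: vectorspace K V by fact
  interpret W: vectorspace K W by fact
  note [simp] = module_hom_restrict[OF V.module_axioms]
  have mem: "f x \<in> carrier W" if "f \<in> module_hom K V W" "x \<in> carrier V" for f x
    using that unfolding module_hom_def by auto
  have add: "(\<lambda>x. f x \<oplus>\<^bsub>W\<^esub> g x) \<in> module_hom K V W"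
    if "f \<in> module_hom K V W" "g \<in> module_hom K V W" for f g
    using that unfolding module_hom_def
    by (auto simp: Pi_iff W.M.a_ac W.smult_r_distr)
  \<comment> \<open>Here the commutativity of \<open>K\<close> enters: the scalar \<open>a\<close>
    has to move past the scalars pulled out of \<open>f\<close>.\<close>
  have smult: "(\<lambda>x. a \<odot>\<^bsub>W\<^esub> f x) \<in> module_hom K V W"
    if "f \<in> module_hom K V W" "a \<in> carrier K" for f a
    using that unfolding module_hom_def
    by (auto simp: Pi_iff W.smult_r_distr W.smult_assoc1[symmetric] V.R.m_comm)
  have zero: "(\<lambda>x. \<zero>\<^bsub>W\<^esub>) \<in> module_hom K V W"
    unfolding module_hom_def by auto
  have neg: "\<exists>g \<in> carrier (lin_maps K V W). f \<oplus>\<^bsub>lin_maps K V W\<^esub> g = \<zero>\<^bsub>lin_maps K V W\<^esub>"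
    if f: "f \<in> carrier (lin_maps K V W)" for f
  proof
    \<comment> \<open>Taking minus one times \<open>f\<close> as the negative reduces the existence
      of negatives to closure under scalars.\<close>
    show "(\<ominus>\<^bsub>K\<^esub> \<one>\<^bsub>K\<^esub>) \<odot>\<^bsub>lin_maps K V W\<^esub> f \<in> carrier (lin_maps K V W)"
      using f smult by simp
    show "f \<oplus>\<^bsub>lin_maps K V W\<^esub> ((\<ominus>\<^bsub>K\<^esub> \<one>\<^bsub>K\<^esub>) \<odot>\<^bsub>lin_maps K V W\<^esub> f) = \<zero>\<^bsub>lin_maps K V W\<^esub>"
      using f by (auto simp: W.smult_minus_1 mem W.M.r_neg intro!: restrict_ext)
  qed
  have add_zero: "f \<oplus>\<^bsub>lin_maps K V W\<^esub> \<zero>\<^bsub>lin_maps K V W\<^esub> = f"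
    if f: "f \<in> carrier (lin_maps K V W)" for f
    using f by (intro extensionalityI[of _ "carrier V"]) (simp_all add: mem)
  show ?thesis
  proof (intro vs_criteria V.field_axioms ballI allI impI; (elim conjE)?)
    fix f assume f: "f \<in> carrier (lin_maps K V W)"
    show "\<exists>g \<in> carrier (lin_maps K V W). f \<oplus>\<^bsub>lin_maps K V W\<^esub> g = \<zero>\<^bsub>lin_maps K V W\<^esub>"
      by (rule neg[OF f])
    show "f \<oplus>\<^bsub>lin_maps K V W\<^esub> \<zero>\<^bsub>lin_maps K V W\<^esub> = f"
      by (rule add_zero[OF f])
    show "\<one>\<^bsub>K\<^esub> \<odot>\<^bsub>lin_maps K V W\<^esub> f = f"
      using f by (intro extensionalityI[of _ "carrier V"]) (simp_all add: mem)
  next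
    fix f g assume "f \<in> carrier (lin_maps K V W)" "g \<in> carrier (lin_maps K V W)"
    then show "f \<oplus>\<^bsub>lin_maps K V W\<^esub> g \<in> carrier (lin_maps K V W)"
      and "f \<oplus>\<^bsub>lin_maps K V W\<^esub> g = g \<oplus>\<^bsub>lin_maps K V W\<^esub> f"
      by (simp_all add: add mem W.M.a_comm cong: restrict_cong)
  next
    fix f g h assume "f \<in> carrier (lin_maps K V W)" "g \<in> carrier (lin_maps K V W)"
      "h \<in> carrier (lin_maps K V W)"
    then show "f \<oplus>\<^bsub>lin_maps K V W\<^esub> g \<oplus>\<^bsub>lin_maps K V W\<^esub> h =
        f \<oplus>\<^bsub>lin_maps K V W\<^esub> (g \<oplus>\<^bsub>lin_maps K V W\<^esub> h)"
      by (simp add: mem W.M.a_assoc cong: restrict_cong)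
  next
    fix a b f assume "a \<in> carrier K" "b \<in> carrier K" "f \<in> carrier (lin_maps K V W)"
    then show "(a \<otimes>\<^bsub>K\<^esub> b) \<odot>\<^bsub>lin_maps K V W\<^esub> f =
        a \<odot>\<^bsub>lin_maps K V W\<^esub> (b \<odot>\<^bsub>lin_maps K V W\<^esub> f)"
      and "(a \<oplus>\<^bsub>K\<^esub> b) \<odot>\<^bsub>lin_maps K V W\<^esub> f =
        a \<odot>\<^bsub>lin_maps K V W\<^esub> f \<oplus>\<^bsub>lin_maps K V W\<^esub> b \<odot>\<^bsub>lin_maps K V W\<^esub> f"
      by (simp_all add: mem W.smult_assoc1 W.smult_l_distr cong: restrict_cong)
  next
    fix a f g assume "a \<in> carrier K" "f \<in> carrier (lin_maps K V W)" "g \<in> carrier (lin_maps K V W)"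
    then show "a \<odot>\<^bsub>lin_maps K V W\<^esub> (f \<oplus>\<^bsub>lin_maps K V W\<^esub> g) =
        a \<odot>\<^bsub>lin_maps K V W\<^esub> f \<oplus>\<^bsub>lin_maps K V W\<^esub> a \<odot>\<^bsub>lin_maps K V W\<^esub> g"
      and "a \<odot>\<^bsub>lin_maps K V W\<^esub> f \<in> carrier (lin_maps K V W)"
      by (simp_all add: smult mem W.smult_r_distr cong: restrict_cong)
  qed (use zero in simp_all)
qed

text \<open>The evaluations at finitely many generators of \<open>V\<close> form a separating family
  of maps to \<open>W\<close>: the kernel of a map that vanishes on the generators is a submodule
  containing them, hence all of \<open>V\<close>.\<close>

lemma fin_dim_lin_maps:
  assumes V: "vectorspace K V" "vectorspace.fin_dim K V"
    and W: "vectorspace K W" "vectorspace.fin_dim K W"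
  shows "vectorspace.fin_dim K (lin_maps K V W)"
proof -
  obtain A where A: "finite A" "A \<subseteq> carrier V"
    "\<And>N. submodule K N V \<Longrightarrow> A \<subseteq> N \<Longrightarrow> N = carrier V"
    using fin_dimE[OF V] by metis
  show ?thesis
  proof (rule fin_dim_of_separating_family[OF A(1) W vectorspace_lin_maps[OF V(1) W(1)]])
    show "(\<lambda>f. f a) \<in> module_hom K (lin_maps K V W) W" if "a \<in> A" for a
      using that A(2) by (auto simp: module_hom_def subset_iff Pi_iff)
    show "f = \<zero>\<^bsub>lin_maps K V W\<^esub>"
      if f: "f \<in> carrier (lin_maps K V W)" and 0: "\<And>a. a \<in> A \<Longrightarrow> f a = \<zero>\<^bsub>W\<^esub>" for f
    proof -
      interpret f: linear_map K V W f
        using f by (intro linear_mapI V(1) W(1)) simp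
      have "{x \<in> carrier V. f x = \<zero>\<^bsub>W\<^esub>} = carrier V"
        using A(2) 0 f.ker_is_submodule unfolding f.ker_def by (intro A(3)) auto
      then show ?thesis
        using f by (auto intro!: extensionalityI[of _ "carrier V"])
    qed
  qed
qed

section \<open>Moving finite-dimensional spaces to another type of elements\<close>

lemma fin_dim_embeds:
  fixes U :: "('k, 'w) module" and \<iota> :: "'k list \<Rightarrow> 'v"
  assumes "vectorspace K U" "vectorspace.fin_dim K U" and "inj_on \<iota> (lists (carrier K))"
  shows "\<exists>e :: 'w \<Rightarrow> 'v. inj_on e (carrier U)"
proof -
  interpret vectorspace K U by fact
  obtain A where A: "finite A" "A \<subseteq> carrier U" "gen_set A"
    using assms(2) unfolding fin_dim_def by blast
  obtain as where as: "set as = A"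
    using A(1) finite_list by blast
  have "\<exists>a. a \<in> A \<rightarrow> carrier K \<and> lincomb a A = x" if "x \<in> carrier U" for x
    using finite_in_span[OF A(1,2)] A(3) that by blast
  then obtain a where a: "\<And>x. x \<in> carrier U \<Longrightarrow> a x \<in> A \<rightarrow> carrier K \<and> lincomb (a x) A = x"
    by metis
  \<comment> \<open>The generators may be dependent: \<open>a x\<close> is one chosen family of
    coefficients, and \<open>lincomb\<close> recovers \<open>x\<close> from it. The list of these
    coefficients is then encoded by \<iota>.\<close>
  have "inj_on (\<lambda>x. \<iota> (map (a x) as)) (carrier U)"
  proof (rule inj_onI)
    fix x y assume xy: "x \<in> carrier U" "y \<in> carrier U" "\<iota> (map (a x) as) = \<iota> (map (a y) as)"
    have "set (map (a x) as) \<subseteq> carrier K" "set (map (a y) as) \<subseteq> carrier K"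
      using a[OF xy(1)] a[OF xy(2)] as by (auto simp: Pi_iff)
    then have "map (a x) as = map (a y) as"
      using inj_onD[OF assms(3) xy(3)] by (simp add: lists_eq_set)
    then have "\<And>v. v \<in> A \<Longrightarrow> a x v = a y v"
      using as by simp
    then have "lincomb (a x) A = lincomb (a y) A"
      using a[OF xy(1)] a[OF xy(2)] A(2) by (intro lincomb_cong) auto
    then show "x = y"
      using a xy by metis
  qed
  then show ?thesis by blast
qed

definition transport :: "('w \<Rightarrow> 'v) \<Rightarrow> ('k, 'w) module \<Rightarrow> ('k, 'v) module" where
  "transport e U = (let d = inv_into (carrier U) e in
    \<lparr>carrier = e ` carrier U,
     mult = (\<lambda>x y. e \<zero>\<^bsub>U\<^esub>),
     one = e \<zero>\<^bsub>U\<^esub>,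
     zero = e \<zero>\<^bsub>U\<^esub>,
     add = (\<lambda>x y. e (d x \<oplus>\<^bsub>U\<^esub> d y)),
     smult = (\<lambda>a x. e (a \<odot>\<^bsub>U\<^esub> d x))\<rparr>)"

lemma transport_iso:
  assumes U: "vectorspace K U" "vectorspace.fin_dim K U" and e: "inj_on e (carrier U)"
  shows "vectorspace K (transport e U)" "vectorspace.fin_dim K (transport e U)"
    and "e \<in> module_hom K U (transport e U)" "bij_betw e (carrier U) (carrier (transport e U))"
proof -
  interpret U: vectorspace K U by fact
  note [simp] = transport_def Let_def inv_into_f_f[OF e]
  show vs: "vectorspace K (transport e U)"
  proof (intro vs_criteria U.field_axioms)
    show "\<forall>v\<in>carrier (transport e U). \<exists>w\<in>carrier (transport e U).
        v \<oplus>\<^bsub>transport e U\<^esub> w = \<zero>\<^bsub>transport e U\<^esub>"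
      by (auto intro!: arg_cong[of _ _ e] U.M.r_neg)
  qed (auto simp: U.M.a_ac U.smult_l_distr U.smult_r_distr U.smult_assoc1)
  show hom: "e \<in> module_hom K U (transport e U)"
    unfolding module_hom_def by auto
  show bij: "bij_betw e (carrier U) (carrier (transport e U))"
    using e by (simp add: bij_betw_def)
  show "vectorspace.fin_dim K (transport e U)"
    using linear_map.surj_fin_dim[OF linear_mapI[OF U(1) vs hom] U(2)] by simp
qed

lemma module_hom_inv_into:
  assumes "module K V" and f: "f \<in> module_hom K V W" "bij_betw f (carrier V) (carrier W)"
  shows "inv_into (carrier V) f \<in> module_hom K W V"
proof -
  interpret V: module K V by fact
  let ?g = "inv_into (carrier V) f"
  have inv: "?g (f x) = x" if "x \<in> carrier V" for x
    using that f(2) by (simp add: bij_betw_def)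
  have onto: "\<exists>x \<in> carrier V. y = f x" if "y \<in> carrier W" for y
    using that f(2) by (auto simp: bij_betw_def)
  have "?g (y \<oplus>\<^bsub>W\<^esub> y') = ?g y \<oplus>\<^bsub>V\<^esub> ?g y'" if y: "y \<in> carrier W" "y' \<in> carrier W" for y y'
  proof -
    obtain x x' where x: "x \<in> carrier V" "x' \<in> carrier V" "y = f x" "y' = f x'"
      using onto y by metis
    then show ?thesis
      using inv[of "x \<oplus>\<^bsub>V\<^esub> x'"] by (simp add: inv module_hom_add[OF f(1)])
  qed
  moreover have "?g (a \<odot>\<^bsub>W\<^esub> y) = a \<odot>\<^bsub>V\<^esub> ?g y" if y: "a \<in> carrier K" "y \<in> carrier W" for a y
  proof -
    obtain x where x: "x \<in> carrier V" "y = f x"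
      using onto y by metis
    then show ?thesis
      using inv[of "a \<odot>\<^bsub>V\<^esub> x"] y(1) by (simp add: inv module_hom_smult[OF f(1)])
  qed
  moreover have "?g y \<in> carrier V" if "y \<in> carrier W" for y
    using onto[OF that] by (auto simp: inv)
  ultimately show ?thesis
    unfolding module_hom_def by simp
qed

section \<open>Categories and adjunctions\<close>

text \<open>The record \<open>lin_cat\<close> imposes no laws and \<open>adjunction\<close> does not
  include them either. Those needed to compute with the triangle identities are collected
  here.\<close>

locale category =
  fixes C :: "('k, 'o, 'm) lin_cat"
  assumes ident: "X \<in> Obj C \<Longrightarrow> Ident C X \<in> carrier (Hom C X X)"
    and comp: "\<lbrakk>X \<in> Obj C; Y \<in> Obj C; Z \<in> Obj C;
      f \<in> carrier (Hom C X Y); g \<in> carrier (Hom C Y Z)\<rbrakk> \<Longrightarrow> Comp C X Y Z g f \<in> carrier (Hom C X Z)"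
    and comp_ident: "\<lbrakk>X \<in> Obj C; Y \<in> Obj C; f \<in> carrier (Hom C X Y)\<rbrakk> \<Longrightarrow>
      Comp C X X Y f (Ident C X) = f"
    and ident_comp: "\<lbrakk>X \<in> Obj C; Y \<in> Obj C; f \<in> carrier (Hom C X Y)\<rbrakk> \<Longrightarrow>
      Comp C X Y Y (Ident C Y) f = f"
    and comp_assoc: "\<lbrakk>X \<in> Obj C; Y \<in> Obj C; Z \<in> Obj C; W \<in> Obj C;
      f \<in> carrier (Hom C X Y); g \<in> carrier (Hom C Y Z); h \<in> carrier (Hom C Z W)\<rbrakk> \<Longrightarrow>
      Comp C X Z W h (Comp C X Y Z g f) = Comp C X Y W (Comp C Y Z W h g) f"

lemma functor_obj: "is_functor C D F \<Longrightarrow> X \<in> Obj C \<Longrightarrow> on_obj F X \<in> Obj D"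
  unfolding is_functor_def by blast

lemma functor_mor:
  "is_functor C D F \<Longrightarrow> X \<in> Obj C \<Longrightarrow> Y \<in> Obj C \<Longrightarrow> f \<in> carrier (Hom C X Y) \<Longrightarrow>
    on_mor F X Y f \<in> carrier (Hom D (on_obj F X) (on_obj F Y))"
  unfolding is_functor_def by blast

lemma functor_ident:
  "is_functor C D F \<Longrightarrow> X \<in> Obj C \<Longrightarrow> on_mor F X X (Ident C X) = Ident D (on_obj F X)"
  unfolding is_functor_def by blast

lemma functor_comp:
  "is_functor C D F \<Longrightarrow> X \<in> Obj C \<Longrightarrow> Y \<in> Obj C \<Longrightarrow> Z \<in> Obj C \<Longrightarrow>
    f \<in> carrier (Hom C X Y) \<Longrightarrow> g \<in> carrier (Hom C Y Z) \<Longrightarrow>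
    on_mor F X Z (Comp C X Y Z g f) =
    Comp D (on_obj F X) (on_obj F Y) (on_obj F Z) (on_mor F Y Z g) (on_mor F X Y f)"
  unfolding is_functor_def by blast

lemma nat_transf_mor:
  "nat_transf C D F G \<alpha> \<Longrightarrow> X \<in> Obj C \<Longrightarrow> \<alpha> X \<in> carrier (Hom D (on_obj F X) (on_obj G X))"
  unfolding nat_transf_def by blast

lemma nat_transf_natural:
  "nat_transf C D F G \<alpha> \<Longrightarrow> X \<in> Obj C \<Longrightarrow> Y \<in> Obj C \<Longrightarrow> f \<in> carrier (Hom C X Y) \<Longrightarrow>
    Comp D (on_obj F X) (on_obj F Y) (on_obj G Y) (\<alpha> Y) (on_mor F X Y f) =
    Comp D (on_obj F X) (on_obj G X) (on_obj G Y) (on_mor G X Y f) (\<alpha> X)"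
  unfolding nat_transf_def by blast

lemma comp_functor_simps [simp]:
  "on_obj (comp_functor G F) X = on_obj G (on_obj F X)"
  "on_mor (comp_functor G F) X Y f = on_mor G (on_obj F X) (on_obj F Y) (on_mor F X Y f)"
  by (simp_all add: comp_functor_def)

lemma id_functor_simps [simp]: "on_obj id_functor X = X" "on_mor id_functor X Y f = f"
  by (simp_all add: id_functor_def)

lemma precomp_simps:
  "on_obj (precomp B j) F = comp_functor F j"
  "on_mor (precomp B j) F G \<alpha> = (\<lambda>X \<in> Obj B. \<alpha> (on_obj j X))"
  by (simp_all add: precomp_def)

section \<open>Transposition along an adjunction\<close>

locale adjoint_pair = C: category C + D: category D
  for C :: "('k, 'o1, 'm1) lin_cat" and D :: "('k, 'o2, 'm2) lin_cat" +
  fixes L :: "('o1, 'm1, 'o2, 'm2) cfunctor" and R :: "('o2, 'm2, 'o1, 'm1) cfunctor"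
    and \<eta> :: "'o1 \<Rightarrow> 'm1" and \<epsilon> :: "'o2 \<Rightarrow> 'm2"
  assumes adjunction: "adjunction C D L R \<eta> \<epsilon>"
begin

lemma L: "is_functor C D L"
  and R: "is_functor D C R"
  and \<eta>_nat: "nat_transf C C id_functor (comp_functor R L) \<eta>"
  and \<epsilon>_nat: "nat_transf D D (comp_functor L R) id_functor \<epsilon>"
  and triangle_L: "X \<in> Obj C \<Longrightarrow>
    Comp D (on_obj L X) (on_obj L (on_obj R (on_obj L X))) (on_obj L X) (\<epsilon> (on_obj L X))
      (on_mor L X (on_obj R (on_obj L X)) (\<eta> X)) = Ident D (on_obj L X)"
  and triangle_R: "Y \<in> Obj D \<Longrightarrow>
    Comp C (on_obj R Y) (on_obj R (on_obj L (on_obj R Y))) (on_obj R Y)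
      (on_mor R (on_obj L (on_obj R Y)) Y (\<epsilon> Y)) (\<eta> (on_obj R Y)) = Ident C (on_obj R Y)"
  using adjunction[unfolded adjunction_def Let_def] by simp_all

lemmas L_obj = functor_obj[OF L] and R_obj = functor_obj[OF R]
  and L_mor = functor_mor[OF L] and R_mor = functor_mor[OF R]
  and L_comp = functor_comp[OF L] and R_comp = functor_comp[OF R]

lemma \<eta>_mor: "X \<in> Obj C \<Longrightarrow> \<eta> X \<in> carrier (Hom C X (on_obj R (on_obj L X)))"
  using nat_transf_mor[OF \<eta>_nat] by simp

lemma \<epsilon>_mor: "Y \<in> Obj D \<Longrightarrow> \<epsilon> Y \<in> carrier (Hom D (on_obj L (on_obj R Y)) Y)"
  using nat_transf_mor[OF \<epsilon>_nat] by simp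

lemma \<eta>_natural:
  "X \<in> Obj C \<Longrightarrow> Y \<in> Obj C \<Longrightarrow> f \<in> carrier (Hom C X Y) \<Longrightarrow>
    Comp C X (on_obj R (on_obj L X)) (on_obj R (on_obj L Y))
      (on_mor R (on_obj L X) (on_obj L Y) (on_mor L X Y f)) (\<eta> X) =
    Comp C X Y (on_obj R (on_obj L Y)) (\<eta> Y) f"
  using nat_transf_natural[OF \<eta>_nat, of X Y f] by simp

lemma \<epsilon>_natural:
  "X \<in> Obj D \<Longrightarrow> Y \<in> Obj D \<Longrightarrow> f \<in> carrier (Hom D X Y) \<Longrightarrow>
    Comp D (on_obj L (on_obj R X)) (on_obj L (on_obj R Y)) Y (\<epsilon> Y)
      (on_mor L (on_obj R X) (on_obj R Y) (on_mor R X Y f)) =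
    Comp D (on_obj L (on_obj R X)) X Y f (\<epsilon> X)"
  using nat_transf_natural[OF \<epsilon>_nat, of X Y f] by simp

text \<open>Transposing \<open>g\<close> to \<epsilon> after \<open>L g\<close> and back: naturality
  of \<eta> moves \<open>g\<close> to the right of \<eta>, and what stands before it collapses by
  the triangle identity for \<open>R\<close>.\<close>

lemma transpose_counit:
  assumes X: "X \<in> Obj C" and Y: "Y \<in> Obj D" and g: "g \<in> carrier (Hom C X (on_obj R Y))"
  shows "Comp C X (on_obj R (on_obj L X)) (on_obj R Y)
    (on_mor R (on_obj L X) Y
      (Comp D (on_obj L X) (on_obj L (on_obj R Y)) Y (\<epsilon> Y) (on_mor L X (on_obj R Y) g))) (\<eta> X) = g"
proof -
  let ?LX = "on_obj L X" and ?RY = "on_obj R Y"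
  let ?RLX = "on_obj R ?LX" and ?LRY = "on_obj L ?RY"
  let ?RLRY = "on_obj R ?LRY"
  note [simp] = X Y g L_obj R_obj L_mor R_mor \<eta>_mor \<epsilon>_mor
  have "Comp C X ?RLX ?RY (on_mor R ?LX Y (Comp D ?LX ?LRY Y (\<epsilon> Y) (on_mor L X ?RY g))) (\<eta> X) =
      Comp C X ?RLRY ?RY (on_mor R ?LRY Y (\<epsilon> Y))
        (Comp C X ?RLX ?RLRY (on_mor R ?LX ?LRY (on_mor L X ?RY g)) (\<eta> X))"
    by (simp add: R_comp C.comp_assoc)
  also have "\<dots> = Comp C X ?RY ?RY (Comp C ?RY ?RLRY ?RY (on_mor R ?LRY Y (\<epsilon> Y)) (\<eta> ?RY)) g"
    by (simp add: \<eta>_natural C.comp_assoc)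
  also have "\<dots> = g"
    by (simp add: triangle_R C.ident_comp)
  finally show ?thesis .
qed

text \<open>Sending \<open>g\<close> to \<epsilon> after \<open>L g\<close> has a left inverse by
  \<open>transpose_counit\<close>. With \<open>counit_factor\<close> this describes maps into
  \<open>R Y\<close>, which is what is known about a right Kan extension.\<close>

lemma counit_cancel:
  assumes "X \<in> Obj C" "Y \<in> Obj D"
    and "g \<in> carrier (Hom C X (on_obj R Y))" "g' \<in> carrier (Hom C X (on_obj R Y))"
    and "Comp D (on_obj L X) (on_obj L (on_obj R Y)) Y (\<epsilon> Y) (on_mor L X (on_obj R Y) g) =
      Comp D (on_obj L X) (on_obj L (on_obj R Y)) Y (\<epsilon> Y) (on_mor L X (on_obj R Y) g')"
  shows "g = g'"
  using transpose_counit[OF assms(1-3)] transpose_counit[OF assms(1,2,4)]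
  unfolding assms(5) by (rule trans[OF sym])

text \<open>The factorization is the transpose of \<open>g\<close>. With \<open>unit_cancel\<close>
  this describes maps out of \<open>L X\<close>, which is what is known about a left Kan
  extension.\<close>

lemma unit_factor:
  assumes X: "X \<in> Obj C" and Y: "Y \<in> Obj D" and g: "g \<in> carrier (Hom C X (on_obj R Y))"
  shows "\<exists>f \<in> carrier (Hom D (on_obj L X) Y).
    Comp C X (on_obj R (on_obj L X)) (on_obj R Y) (on_mor R (on_obj L X) Y f) (\<eta> X) = g"
proof (rule bexI)
  show "Comp C X (on_obj R (on_obj L X)) (on_obj R Y) (on_mor R (on_obj L X) Y
      (Comp D (on_obj L X) (on_obj L (on_obj R Y)) Y (\<epsilon> Y) (on_mor L X (on_obj R Y) g))) (\<eta> X) = g"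
    by (rule transpose_counit[OF assms])
  show "Comp D (on_obj L X) (on_obj L (on_obj R Y)) Y (\<epsilon> Y) (on_mor L X (on_obj R Y) g)
      \<in> carrier (Hom D (on_obj L X) Y)"
    by (intro D.comp L_obj R_obj L_mor \<epsilon>_mor assms)
qed

text \<open>The other composite of the two transpositions: naturality of \<epsilon> moves
  \<open>f\<close> to the left, and the triangle identity for \<open>L\<close> removes the
  rest.\<close>

lemma transpose_unit:
  assumes X: "X \<in> Obj C" and Y: "Y \<in> Obj D" and f: "f \<in> carrier (Hom D (on_obj L X) Y)"
  shows "Comp D (on_obj L X) (on_obj L (on_obj R Y)) Y (\<epsilon> Y) (on_mor L X (on_obj R Y)
    (Comp C X (on_obj R (on_obj L X)) (on_obj R Y) (on_mor R (on_obj L X) Y f) (\<eta> X))) = f"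
proof -
  let ?LX = "on_obj L X" and ?RY = "on_obj R Y"
  let ?RLX = "on_obj R ?LX" and ?LRY = "on_obj L ?RY"
  let ?Rf = "on_mor R ?LX Y f"
  let ?g = "Comp C X ?RLX ?RY ?Rf (\<eta> X)"
  note [simp] = X Y f L_obj R_obj L_mor R_mor \<eta>_mor \<epsilon>_mor
  have "Comp D ?LX ?LRY Y (\<epsilon> Y) (on_mor L X ?RY ?g) =
      Comp D ?LX ?LRY Y (\<epsilon> Y)
        (Comp D ?LX (on_obj L ?RLX) ?LRY (on_mor L ?RLX ?RY ?Rf) (on_mor L X ?RLX (\<eta> X)))"
    by (simp add: L_comp)
  also have "\<dots> = Comp D ?LX (on_obj L ?RLX) Y (Comp D (on_obj L ?RLX) ?LRY Y (\<epsilon> Y)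
      (on_mor L ?RLX ?RY ?Rf)) (on_mor L X ?RLX (\<eta> X))"
    by (simp add: D.comp_assoc)
  also have "\<dots> = Comp D ?LX ?LX Y f (Comp D ?LX (on_obj L ?RLX) ?LX (\<epsilon> ?LX) (on_mor L X ?RLX (\<eta> X)))"
    by (simp add: \<epsilon>_natural D.comp_assoc)
  also have "\<dots> = f"
    by (simp add: triangle_L D.comp_ident)
  finally show ?thesis .
qed

lemma counit_factor:
  assumes X: "X \<in> Obj C" and Y: "Y \<in> Obj D" and f: "f \<in> carrier (Hom D (on_obj L X) Y)"
  shows "\<exists>g \<in> carrier (Hom C X (on_obj R Y)).
    Comp D (on_obj L X) (on_obj L (on_obj R Y)) Y (\<epsilon> Y) (on_mor L X (on_obj R Y) g) = f"
proof (rule bexI)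
  show "Comp D (on_obj L X) (on_obj L (on_obj R Y)) Y (\<epsilon> Y) (on_mor L X (on_obj R Y)
      (Comp C X (on_obj R (on_obj L X)) (on_obj R Y) (on_mor R (on_obj L X) Y f) (\<eta> X))) = f"
    by (rule transpose_unit[OF assms])
  show "Comp C X (on_obj R (on_obj L X)) (on_obj R Y) (on_mor R (on_obj L X) Y f) (\<eta> X)
      \<in> carrier (Hom C X (on_obj R Y))"
    by (intro C.comp L_obj R_obj R_mor \<eta>_mor assms)
qed

lemma unit_cancel:
  assumes "X \<in> Obj C" "Y \<in> Obj D"
    and "f \<in> carrier (Hom D (on_obj L X) Y)" "f' \<in> carrier (Hom D (on_obj L X) Y)"
    and "Comp C X (on_obj R (on_obj L X)) (on_obj R Y) (on_mor R (on_obj L X) Y f) (\<eta> X) =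
      Comp C X (on_obj R (on_obj L X)) (on_obj R Y) (on_mor R (on_obj L X) Y f') (\<eta> X)"
  shows "f = f'"
  using transpose_unit[OF assms(1-3)] transpose_unit[OF assms(1,2,4)]
  unfolding assms(5) by (rule trans[OF sym])

end

section \<open>Functor categories\<close>

lemma functor_cat_simps [simp]:
  "F \<in> Obj (functor_cat K C D) \<longleftrightarrow> linear_functor K C D F"
  "\<alpha> \<in> carrier (Hom (functor_cat K C D) F G) \<longleftrightarrow> \<alpha> \<in> extensional (Obj C) \<and> nat_transf C D F G \<alpha>"
  "Ident (functor_cat K C D) F = (\<lambda>X \<in> Obj C. Ident D (on_obj F X))"
  "Comp (functor_cat K C D) F G H \<beta> \<alpha> =
    (\<lambda>X \<in> Obj C. Comp D (on_obj F X) (on_obj G X) (on_obj H X) (\<beta> X) (\<alpha> X))"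
  by (simp_all add: functor_cat_def)

lemma linear_functor_is_functor: "linear_functor K C D F \<Longrightarrow> is_functor C D F"
  unfolding linear_functor_def by blast

lemma linear_functor_obj: "linear_functor K C D F \<Longrightarrow> X \<in> Obj C \<Longrightarrow> on_obj F X \<in> Obj D"
  using functor_obj linear_functor_is_functor by metis

lemma linear_functor_mor:
  "linear_functor K C D F \<Longrightarrow> X \<in> Obj C \<Longrightarrow> Y \<in> Obj C \<Longrightarrow> f \<in> carrier (Hom C X Y) \<Longrightarrow>
    on_mor F X Y f \<in> carrier (Hom D (on_obj F X) (on_obj F Y))"
  using functor_mor linear_functor_is_functor by metis

lemma restrict_eqI: "f \<in> extensional A \<Longrightarrow> (\<And>x. x \<in> A \<Longrightarrow> g x = f x) \<Longrightarrow> restrict g A = f"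
  by (rule extensionalityI[of _ A]) auto

text \<open>The laws hold objectwise in \<open>D\<close>; composites are natural by pasting two
  naturality squares. This makes the transposition lemmas available for adjunctions between functor
  categories.\<close>

lemma category_functor_cat:
  assumes "category D"
  shows "category (functor_cat K C D)"
proof -
  interpret D: category D by fact
  note obj = linear_functor_obj and mor = linear_functor_mor
  show ?thesis
  proof
    fix F assume "F \<in> Obj (functor_cat K C D)"
    then show "Ident (functor_cat K C D) F \<in> carrier (Hom (functor_cat K C D) F F)"
      by (simp add: nat_transf_def D.ident D.comp_ident D.ident_comp obj[of K C D F] mor[of K C D F])
  next
    fix F G H \<alpha> \<beta>
    assume "F \<in> Obj (functor_cat K C D)" "G \<in> Obj (functor_cat K C D)" "H \<in> Obj (functor_cat K C D)"
      "\<alpha> \<in> carrier (Hom (functor_cat K C D) F G)" "\<beta> \<in> carrier (Hom (functor_cat K C D) G H)"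
    then have F: "linear_functor K C D F" and G: "linear_functor K C D G"
      and H: "linear_functor K C D H"
      and \<alpha>: "nat_transf C D F G \<alpha>" and \<beta>: "nat_transf C D G H \<beta>"
      by auto
    note [simp] = obj[OF F] obj[OF G] obj[OF H] mor[OF F] mor[OF G] mor[OF H]
      nat_transf_mor[OF \<alpha>] nat_transf_mor[OF \<beta>]
    have "Comp D (on_obj F X) (on_obj F Y) (on_obj H Y)
        (Comp D (on_obj F Y) (on_obj G Y) (on_obj H Y) (\<beta> Y) (\<alpha> Y)) (on_mor F X Y f) =
      Comp D (on_obj F X) (on_obj H X) (on_obj H Y) (on_mor H X Y f)
        (Comp D (on_obj F X) (on_obj G X) (on_obj H X) (\<beta> X) (\<alpha> X))"
      if [simp]: "X \<in> Obj C" "Y \<in> Obj C" "f \<in> carrier (Hom C X Y)" for X Y f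
    proof -
      have "Comp D (on_obj F X) (on_obj F Y) (on_obj H Y)
          (Comp D (on_obj F Y) (on_obj G Y) (on_obj H Y) (\<beta> Y) (\<alpha> Y)) (on_mor F X Y f) =
        Comp D (on_obj F X) (on_obj G Y) (on_obj H Y) (\<beta> Y)
          (Comp D (on_obj F X) (on_obj F Y) (on_obj G Y) (\<alpha> Y) (on_mor F X Y f))"
        by (simp add: D.comp_assoc)
      also have "\<dots> = Comp D (on_obj F X) (on_obj G X) (on_obj H Y)
          (Comp D (on_obj G X) (on_obj G Y) (on_obj H Y) (\<beta> Y) (on_mor G X Y f)) (\<alpha> X)"
        by (simp add: D.comp_assoc nat_transf_natural[OF \<alpha>])
      also have "\<dots> = Comp D (on_obj F X) (on_obj H X) (on_obj H Y) (on_mor H X Y f)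
          (Comp D (on_obj F X) (on_obj G X) (on_obj H X) (\<beta> X) (\<alpha> X))"
        by (simp add: D.comp_assoc nat_transf_natural[OF \<beta>])
      finally show ?thesis .
    qed
    then show "Comp (functor_cat K C D) F G H \<beta> \<alpha> \<in> carrier (Hom (functor_cat K C D) F H)"
      by (simp add: nat_transf_def D.comp)
  next
    fix F G \<alpha>
    assume "F \<in> Obj (functor_cat K C D)" "G \<in> Obj (functor_cat K C D)"
      "\<alpha> \<in> carrier (Hom (functor_cat K C D) F G)"
    then have F: "linear_functor K C D F" and G: "linear_functor K C D G"
      and ext: "\<alpha> \<in> extensional (Obj C)" and \<alpha>: "nat_transf C D F G \<alpha>"
      by auto
    show "Comp (functor_cat K C D) F F G \<alpha> (Ident (functor_cat K C D) F) = \<alpha>"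
      unfolding functor_cat_simps
      by (rule restrict_eqI[OF ext]) (simp add: obj[OF F] obj[OF G] nat_transf_mor[OF \<alpha>] D.comp_ident)
    show "Comp (functor_cat K C D) F G G (Ident (functor_cat K C D) G) \<alpha> = \<alpha>"
      unfolding functor_cat_simps
      by (rule restrict_eqI[OF ext]) (simp add: obj[OF F] obj[OF G] nat_transf_mor[OF \<alpha>] D.ident_comp)
  next
    fix F G H I \<alpha> \<beta> \<gamma>
    assume "F \<in> Obj (functor_cat K C D)" "G \<in> Obj (functor_cat K C D)"
      "H \<in> Obj (functor_cat K C D)" "I \<in> Obj (functor_cat K C D)"
      "\<alpha> \<in> carrier (Hom (functor_cat K C D) F G)" "\<beta> \<in> carrier (Hom (functor_cat K C D) G H)"
      "\<gamma> \<in> carrier (Hom (functor_cat K C D) H I)"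
    then have F: "linear_functor K C D F" and G: "linear_functor K C D G"
      and H: "linear_functor K C D H" and I: "linear_functor K C D I"
      and \<alpha>: "nat_transf C D F G \<alpha>" and \<beta>: "nat_transf C D G H \<beta>" and \<gamma>: "nat_transf C D H I \<gamma>"
      by auto
    show "Comp (functor_cat K C D) F H I \<gamma> (Comp (functor_cat K C D) F G H \<beta> \<alpha>) =
      Comp (functor_cat K C D) F G I (Comp (functor_cat K C D) G H I \<gamma> \<beta>) \<alpha>"
      unfolding functor_cat_simps
      by (rule restrict_ext)
        (simp add: obj[OF F] obj[OF G] obj[OF H] obj[OF I] D.comp_assoc
          nat_transf_mor[OF \<alpha>] nat_transf_mor[OF \<beta>] nat_transf_mor[OF \<gamma>])
  qed
qed

text \<open>Inverses chosen objectwise are automatically natural, so isomorphisms of functors can be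
  recognized on components.\<close>

lemma is_iso_functor_cat:
  assumes D: "category D" and F: "linear_functor K C D F" and G: "linear_functor K C D G"
    and \<alpha>: "\<alpha> \<in> carrier (Hom (functor_cat K C D) F G)"
    and iso: "\<And>X. X \<in> Obj C \<Longrightarrow> is_iso D (on_obj F X) (on_obj G X) (\<alpha> X)"
  shows "is_iso (functor_cat K C D) F G \<alpha>"
proof -
  interpret D: category D by fact
  have nat: "nat_transf C D F G \<alpha>"
    using \<alpha> by simp
  obtain \<beta> where \<beta>: "\<And>X. X \<in> Obj C \<Longrightarrow> \<beta> X \<in> carrier (Hom D (on_obj G X) (on_obj F X))"
    "\<And>X. X \<in> Obj C \<Longrightarrow> Comp D (on_obj F X) (on_obj G X) (on_obj F X) (\<beta> X) (\<alpha> X) = Ident D (on_obj F X)"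
    "\<And>X. X \<in> Obj C \<Longrightarrow> Comp D (on_obj G X) (on_obj F X) (on_obj G X) (\<alpha> X) (\<beta> X) = Ident D (on_obj G X)"
    using iso unfolding is_iso_def by metis
  note [simp] = linear_functor_obj[OF F] linear_functor_obj[OF G] linear_functor_mor[OF F]
    linear_functor_mor[OF G] nat_transf_mor[OF nat] \<beta>(1)
  have natural: "Comp D (on_obj G X) (on_obj G Y) (on_obj F Y) (\<beta> Y) (on_mor G X Y f) =
      Comp D (on_obj G X) (on_obj F X) (on_obj F Y) (on_mor F X Y f) (\<beta> X)"
    if [simp]: "X \<in> Obj C" "Y \<in> Obj C" "f \<in> carrier (Hom C X Y)" for X Y f
  proof -
    let ?C = "Comp D"
    let ?FX = "on_obj F X" and ?FY = "on_obj F Y" and ?GX = "on_obj G X" and ?GY = "on_obj G Y"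
    let ?Ff = "on_mor F X Y f" and ?Gf = "on_mor G X Y f"
    \<comment> \<open>The identity of \<open>G X\<close> is inserted as \<alpha> after \<beta>.
      Naturality of \<alpha> then brings \<open>\<alpha> Y\<close> next to \<open>\<beta> Y\<close>,
      where the two cancel.\<close>
    have "?C ?GX ?GY ?FY (\<beta> Y) ?Gf = ?C ?GX ?GY ?FY (\<beta> Y) (?C ?GX ?GX ?GY ?Gf (?C ?GX ?FX ?GX (\<alpha> X) (\<beta> X)))"
      by (simp add: \<beta>(3) D.comp_ident)
    also have "\<dots> = ?C ?GX ?GY ?FY (\<beta> Y) (?C ?GX ?FX ?GY (?C ?FX ?FY ?GY (\<alpha> Y) ?Ff) (\<beta> X))"
      by (simp add: D.comp_assoc nat_transf_natural[OF nat])
    also have "\<dots> = ?C ?GX ?FX ?FY (?C ?FX ?FY ?FY (?C ?FY ?GY ?FY (\<beta> Y) (\<alpha> Y)) ?Ff) (\<beta> X)"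
      by (simp add: D.comp_assoc D.comp)
    also have "\<dots> = ?C ?GX ?FX ?FY ?Ff (\<beta> X)"
      by (simp add: \<beta>(2) D.ident_comp)
    finally show ?thesis .
  qed
  have "restrict \<beta> (Obj C) \<in> carrier (Hom (functor_cat K C D) G F)"
    using natural by (simp add: nat_transf_def)
  then show ?thesis
    using \<alpha> unfolding is_iso_def by (intro conjI bexI[of _ "restrict \<beta> (Obj C)"])
      (simp_all add: \<beta>(2,3) cong: restrict_cong)
qed

section \<open>The category of vector spaces\<close>

lemma Vect_simps [simp]:
  "V \<in> Obj (Vect K) \<longleftrightarrow> vectorspace K V \<and> vectorspace.fin_dim K V"
  "Hom (Vect K) = lin_maps K"
  "Ident (Vect K) V = (\<lambda>x \<in> carrier V. x)"
  "Comp (Vect K) U V W g f = compose (carrier U) g f"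
  by (simp_all add: Vect_def)

lemma module_hom_mem: "f \<in> module_hom K V W \<Longrightarrow> x \<in> carrier V \<Longrightarrow> f x \<in> carrier W"
  unfolding module_hom_def by blast

lemma module_hom_id: "(\<lambda>x. x) \<in> module_hom K V V"
  unfolding module_hom_def by simp

lemma module_hom_comp:
  "f \<in> module_hom K U V \<Longrightarrow> g \<in> module_hom K V W \<Longrightarrow> (\<lambda>x. g (f x)) \<in> module_hom K U W"
  unfolding module_hom_def by (simp add: Pi_iff)

lemma module_hom_compose:
  assumes "module K U" "f \<in> module_hom K U V" "g \<in> module_hom K V W"
  shows "compose (carrier U) g f \<in> module_hom K U W"
  using module_hom_comp[OF assms(2,3)] module_hom_restrict[OF assms(1)] unfolding compose_def by blast

lemma category_Vect: "category (Vect K)"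
proof
  fix U V W :: "('a, 'b) module" and f g
  assume "U \<in> Obj (Vect K)" "f \<in> carrier (Hom (Vect K) U V)" "g \<in> carrier (Hom (Vect K) V W)"
  then show "Comp (Vect K) U V W g f \<in> carrier (Hom (Vect K) U W)"
    by (simp add: module_hom_compose[of K U f V g W] vectorspace_def)
next
  fix V :: "('a, 'b) module" assume "V \<in> Obj (Vect K)"
  then show "Ident (Vect K) V \<in> carrier (Hom (Vect K) V V)"
    by (simp add: module_hom_restrict module_hom_id vectorspace_def)
next
  fix U V W Z :: "('a, 'b) module" and f g h
  assume f: "f \<in> carrier (Hom (Vect K) U V)"
  then have mem: "f x \<in> carrier V" if "x \<in> carrier U" for x
    using that module_hom_mem[of f K U V x] by simp
  show "Comp (Vect K) U U V f (Ident (Vect K) U) = f" "Comp (Vect K) U V V (Ident (Vect K) V) f = f"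
    using f unfolding Vect_simps compose_def by (auto intro!: restrict_eqI simp: mem)
  show "Comp (Vect K) U W Z h (Comp (Vect K) U V W g f) =
      Comp (Vect K) U V Z (Comp (Vect K) V W Z h g) f"
    unfolding Vect_simps compose_def by (rule restrict_ext) (simp add: mem)
qed

lemma is_iso_Vect:
  assumes V: "vectorspace K V" and W: "vectorspace K W"
    and f: "f \<in> carrier (lin_maps K V W)" "bij_betw f (carrier V) (carrier W)"
  shows "is_iso (Vect K) V W f"
proof -
  let ?g = "restrict (inv_into (carrier V) f) (carrier W)"
  have VW: "module K V" "module K W"
    using V W unfolding vectorspace_def by auto
  have "?g \<in> carrier (lin_maps K W V)"
    using module_hom_inv_into[OF VW(1) _ f(2)] f(1) module_hom_restrict[OF VW(2)] by auto
  moreover have "compose (carrier V) ?g f = (\<lambda>x \<in> carrier V. x)"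
    "compose (carrier W) f ?g = (\<lambda>x \<in> carrier W. x)"
    using module_hom_mem[of f K V W] f(1)
      module_hom_mem[OF module_hom_inv_into[OF VW(1) _ f(2)]]
    unfolding compose_def
    by (auto intro!: restrict_ext simp: bij_betw_inv_into_left[OF f(2)] bij_betw_inv_into_right[OF f(2)])
  ultimately show ?thesis
    using f(1) unfolding is_iso_def Vect_simps by blast
qed

section \<open>Linear functors to vector spaces\<close>

text \<open>Both sides of each equation between morphisms of \<open>Vect K\<close> are extensional,
  so values at vectors suffice. \<open>HomC\<close> makes sums and multiples of morphisms of
  \<open>C\<close> morphisms again, so that \<open>ext\<close> covers their images too.\<close>

lemma linear_functor_VectI:
  assumes "\<And>X. X \<in> Obj C \<Longrightarrow> vectorspace K (on_obj F X)"
    and "\<And>X. X \<in> Obj C \<Longrightarrow> vectorspace.fin_dim K (on_obj F X)"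
    and mor: "\<And>X Y f. X \<in> Obj C \<Longrightarrow> Y \<in> Obj C \<Longrightarrow> f \<in> carrier (Hom C X Y) \<Longrightarrow>
      on_mor F X Y f \<in> module_hom K (on_obj F X) (on_obj F Y)"
    and ext: "\<And>X Y f. X \<in> Obj C \<Longrightarrow> Y \<in> Obj C \<Longrightarrow> f \<in> carrier (Hom C X Y) \<Longrightarrow>
      on_mor F X Y f \<in> extensional (carrier (on_obj F X))"
    and ident: "\<And>X x. X \<in> Obj C \<Longrightarrow> x \<in> carrier (on_obj F X) \<Longrightarrow> on_mor F X X (Ident C X) x = x"
    and comp: "\<And>X Y Z f g x. X \<in> Obj C \<Longrightarrow> Y \<in> Obj C \<Longrightarrow> Z \<in> Obj C \<Longrightarrow>
      f \<in> carrier (Hom C X Y) \<Longrightarrow> g \<in> carrier (Hom C Y Z) \<Longrightarrow> x \<in> carrier (on_obj F X) \<Longrightarrow>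
      on_mor F X Z (Comp C X Y Z g f) x = on_mor F Y Z g (on_mor F X Y f x)"
    and add: "\<And>X Y f g x. X \<in> Obj C \<Longrightarrow> Y \<in> Obj C \<Longrightarrow>
      f \<in> carrier (Hom C X Y) \<Longrightarrow> g \<in> carrier (Hom C X Y) \<Longrightarrow> x \<in> carrier (on_obj F X) \<Longrightarrow>
      on_mor F X Y (f \<oplus>\<^bsub>Hom C X Y\<^esub> g) x = on_mor F X Y f x \<oplus>\<^bsub>on_obj F Y\<^esub> on_mor F X Y g x"
    and smult: "\<And>X Y a f x. X \<in> Obj C \<Longrightarrow> Y \<in> Obj C \<Longrightarrow>
      a \<in> carrier K \<Longrightarrow> f \<in> carrier (Hom C X Y) \<Longrightarrow> x \<in> carrier (on_obj F X) \<Longrightarrow>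
      on_mor F X Y (a \<odot>\<^bsub>Hom C X Y\<^esub> f) x = a \<odot>\<^bsub>on_obj F Y\<^esub> on_mor F X Y f x"
    and C: "category C" and HomC: "\<And>X Y. X \<in> Obj C \<Longrightarrow> Y \<in> Obj C \<Longrightarrow> vectorspace K (Hom C X Y)"
  shows "linear_functor K C (Vect K) F"
proof -
  have add_closed: "f \<oplus>\<^bsub>Hom C X Y\<^esub> g \<in> carrier (Hom C X Y)"
    if "X \<in> Obj C" "Y \<in> Obj C" "f \<in> carrier (Hom C X Y)" "g \<in> carrier (Hom C X Y)" for X Y f g
  proof -
    interpret vectorspace K "Hom C X Y"
      using that HomC by blast
    show ?thesis
      using that by simp
  qed
  have smult_closed: "a \<odot>\<^bsub>Hom C X Y\<^esub> f \<in> carrier (Hom C X Y)"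
    if "X \<in> Obj C" "Y \<in> Obj C" "a \<in> carrier K" "f \<in> carrier (Hom C X Y)" for X Y f a
  proof -
    interpret vectorspace K "Hom C X Y"
      using that HomC by blast
    show ?thesis
      using that by simp
  qed
  have "is_functor C (Vect K) F"
    unfolding is_functor_def
  proof (intro conjI ballI)
    fix X assume X: "X \<in> Obj C"
    show "on_obj F X \<in> Obj (Vect K)"
      using X assms(1,2) by simp
    show "on_mor F X X (Ident C X) = Ident (Vect K) (on_obj F X)"
      using X by (intro extensionalityI[OF ext[OF X X category.ident[OF C X]]]) (simp_all add: ident)
    fix Y f assume Y: "Y \<in> Obj C" and f: "f \<in> carrier (Hom C X Y)"
    show "on_mor F X Y f \<in> carrier (Hom (Vect K) (on_obj F X) (on_obj F Y))"
      using mor[OF X Y f] ext[OF X Y f] by simp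
  next
    fix X Y Z f g
    assume *: "X \<in> Obj C" "Y \<in> Obj C" "Z \<in> Obj C" "f \<in> carrier (Hom C X Y)" "g \<in> carrier (Hom C Y Z)"
    show "on_mor F X Z (Comp C X Y Z g f) =
      Comp (Vect K) (on_obj F X) (on_obj F Y) (on_obj F Z) (on_mor F Y Z g) (on_mor F X Y f)"
      by (rule extensionalityI[OF ext])
        (use * category.comp[OF C *] in \<open>simp_all add: comp[OF *] compose_def\<close>)
  qed
  moreover have "on_mor F X Y \<in> module_hom K (Hom C X Y) (lin_maps K (on_obj F X) (on_obj F Y))"
    if X: "X \<in> Obj C" and Y: "Y \<in> Obj C" for X Y
    unfolding module_hom_def mem_Collect_eq
  proof (intro conjI allI impI funcsetI; (elim conjE)?)
    fix f assume f: "f \<in> carrier (Hom C X Y)"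
    show "on_mor F X Y f \<in> carrier (lin_maps K (on_obj F X) (on_obj F Y))"
      using mor[OF X Y f] ext[OF X Y f] by simp
    fix g assume g: "g \<in> carrier (Hom C X Y)"
    show "on_mor F X Y (f \<oplus>\<^bsub>Hom C X Y\<^esub> g) =
        on_mor F X Y f \<oplus>\<^bsub>lin_maps K (on_obj F X) (on_obj F Y)\<^esub> on_mor F X Y g"
      using add_closed[OF X Y f g]
      by (intro extensionalityI[OF ext[OF X Y]]) (auto simp: add[OF X Y f g])
  next
    fix a f assume a: "a \<in> carrier K" and f: "f \<in> carrier (Hom C X Y)"
    show "on_mor F X Y (a \<odot>\<^bsub>Hom C X Y\<^esub> f) =
        a \<odot>\<^bsub>lin_maps K (on_obj F X) (on_obj F Y)\<^esub> on_mor F X Y f"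
      using smult_closed[OF X Y a f]
      by (intro extensionalityI[OF ext[OF X Y]]) (auto simp: smult[OF X Y a f])
  qed
  ultimately show ?thesis
    unfolding linear_functor_def by simp
qed

lemma
  assumes F: "linear_functor K C (Vect K) F" and X: "X \<in> Obj C"
  shows Vect_functor_obj: "vectorspace K (on_obj F X)" "vectorspace.fin_dim K (on_obj F X)"
    and Vect_functor_ident: "x \<in> carrier (on_obj F X) \<Longrightarrow> on_mor F X X (Ident C X) x = x"
  using linear_functor_obj[OF F X] functor_ident[OF linear_functor_is_functor[OF F] X] by simp_all

lemma
  assumes F: "linear_functor K C (Vect K) F" and X: "X \<in> Obj C" and Y: "Y \<in> Obj C"
    and f: "f \<in> carrier (Hom C X Y)"
  shows Vect_functor_hom: "on_mor F X Y f \<in> module_hom K (on_obj F X) (on_obj F Y)"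
    and Vect_functor_ext: "on_mor F X Y f \<in> extensional (carrier (on_obj F X))"
    and Vect_functor_mem: "x \<in> carrier (on_obj F X) \<Longrightarrow> on_mor F X Y f x \<in> carrier (on_obj F Y)"
    and Vect_functor_add: "x \<in> carrier (on_obj F X) \<Longrightarrow> g \<in> carrier (Hom C X Y) \<Longrightarrow>
      on_mor F X Y (f \<oplus>\<^bsub>Hom C X Y\<^esub> g) x = on_mor F X Y f x \<oplus>\<^bsub>on_obj F Y\<^esub> on_mor F X Y g x"
    and Vect_functor_smult: "x \<in> carrier (on_obj F X) \<Longrightarrow> a \<in> carrier K \<Longrightarrow>
      on_mor F X Y (a \<odot>\<^bsub>Hom C X Y\<^esub> f) x = a \<odot>\<^bsub>on_obj F Y\<^esub> on_mor F X Y f x"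
    and Vect_functor_comp: "x \<in> carrier (on_obj F X) \<Longrightarrow> Z \<in> Obj C \<Longrightarrow> h \<in> carrier (Hom C Y Z) \<Longrightarrow>
      on_mor F X Z (Comp C X Y Z h f) x = on_mor F Y Z h (on_mor F X Y f x)"
proof -
  have mor: "on_mor F X Y f \<in> module_hom K (on_obj F X) (on_obj F Y) \<inter> extensional (carrier (on_obj F X))"
    using linear_functor_mor[OF F X Y f] by simp
  then show hom: "on_mor F X Y f \<in> module_hom K (on_obj F X) (on_obj F Y)"
    and "on_mor F X Y f \<in> extensional (carrier (on_obj F X))"
    by auto
  show "on_mor F X Y f x \<in> carrier (on_obj F Y)" if "x \<in> carrier (on_obj F X)"
    by (rule module_hom_mem[OF hom that])
  have lin: "on_mor F X Y \<in> module_hom K (Hom C X Y) (lin_maps K (on_obj F X) (on_obj F Y))"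
    using F X Y unfolding linear_functor_def by simp
  show "on_mor F X Y (f \<oplus>\<^bsub>Hom C X Y\<^esub> g) x = on_mor F X Y f x \<oplus>\<^bsub>on_obj F Y\<^esub> on_mor F X Y g x"
    if "x \<in> carrier (on_obj F X)" "g \<in> carrier (Hom C X Y)"
    using module_hom_add[OF lin f that(2)] that(1) by simp
  show "on_mor F X Y (a \<odot>\<^bsub>Hom C X Y\<^esub> f) x = a \<odot>\<^bsub>on_obj F Y\<^esub> on_mor F X Y f x"
    if "x \<in> carrier (on_obj F X)" "a \<in> carrier K"
    using module_hom_smult[OF lin that(2) f] that(1) by simp
  show "on_mor F X Z (Comp C X Y Z h f) x = on_mor F Y Z h (on_mor F X Y f x)"
    if "x \<in> carrier (on_obj F X)" "Z \<in> Obj C" "h \<in> carrier (Hom C Y Z)"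
    using functor_comp[OF linear_functor_is_functor[OF F] X Y that(2) f that(3)] that(1)
    by (simp add: compose_def)
qed

text \<open>Two cut-offs are required: the family has to be extensional on the objects, and each
  component on its source space.\<close>

lemma Vect_nat_transfI:
  assumes F: "linear_functor K C (Vect K) F"
    and a: "\<And>X. X \<in> Obj C \<Longrightarrow> a X \<in> module_hom K (on_obj F X) (on_obj G X)"
    and nat: "\<And>X Y f x. X \<in> Obj C \<Longrightarrow> Y \<in> Obj C \<Longrightarrow> f \<in> carrier (Hom C X Y) \<Longrightarrow>
      x \<in> carrier (on_obj F X) \<Longrightarrow> a Y (on_mor F X Y f x) = on_mor G X Y f (a X x)"
  shows "(\<lambda>X \<in> Obj C. \<lambda>x \<in> carrier (on_obj F X). a X x) \<in>
    carrier (Hom (functor_cat K C (Vect K)) F G)"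
proof -
  have "restrict (a X) (carrier (on_obj F X)) \<in> module_hom K (on_obj F X) (on_obj G X)"
    if "X \<in> Obj C" for X
    using a[OF that] module_hom_restrict Vect_functor_obj(1)[OF F that] unfolding vectorspace_def
    by blast
  then show ?thesis
    by (auto simp: nat_transf_def compose_def nat Vect_functor_mem[OF F] intro!: restrict_ext)
qed

lemma
  assumes \<alpha>: "\<alpha> \<in> carrier (Hom (functor_cat K C (Vect K)) F G)" and X: "X \<in> Obj C"
  shows Vect_nat_transf_mor: "\<alpha> X \<in> carrier (lin_maps K (on_obj F X) (on_obj G X))"
    and Vect_nat_transf_hom: "\<alpha> X \<in> module_hom K (on_obj F X) (on_obj G X)"
    and Vect_nat_transf_mem: "x \<in> carrier (on_obj F X) \<Longrightarrow> \<alpha> X x \<in> carrier (on_obj G X)"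
    and Vect_nat_transf_natural: "x \<in> carrier (on_obj F X) \<Longrightarrow> Y \<in> Obj C \<Longrightarrow>
      f \<in> carrier (Hom C X Y) \<Longrightarrow> \<alpha> Y (on_mor F X Y f x) = on_mor G X Y f (\<alpha> X x)"
proof -
  have nat: "nat_transf C (Vect K) F G \<alpha>"
    using \<alpha> by simp
  show mor: "\<alpha> X \<in> carrier (lin_maps K (on_obj F X) (on_obj G X))"
    using nat_transf_mor[OF nat X] by simp
  then show hom: "\<alpha> X \<in> module_hom K (on_obj F X) (on_obj G X)"
    by simp
  show "\<alpha> X x \<in> carrier (on_obj G X)" if "x \<in> carrier (on_obj F X)"
    by (rule module_hom_mem[OF hom that])
  show "\<alpha> Y (on_mor F X Y f x) = on_mor G X Y f (\<alpha> X x)"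
    if "x \<in> carrier (on_obj F X)" "Y \<in> Obj C" "f \<in> carrier (Hom C X Y)"
    using fun_cong[OF nat_transf_natural[OF nat X that(2,3)], of x] that(1) by (simp add: compose_def)
qed

text \<open>
  Here \<open>F\<close> and \<open>G\<close> may take values in vector spaces over different types, so that this is not an
  instance of \<^const>\<open>nat_iso\<close>.
\<close>

definition linear_iso ::
  "'k ring \<Rightarrow> ('k, 'o, 'm) lin_cat \<Rightarrow> ('o, 'm, ('k, 'v) module, 'v \<Rightarrow> 'v) cfunctor \<Rightarrow>
    ('o, 'm, ('k, 'w) module, 'w \<Rightarrow> 'w) cfunctor \<Rightarrow> ('o \<Rightarrow> 'v \<Rightarrow> 'w) \<Rightarrow> bool"
  where "linear_iso K C F G d \<longleftrightarrow>
    (\<forall>X \<in> Obj C. d X \<in> module_hom K (on_obj F X) (on_obj G X) \<and>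
      bij_betw (d X) (carrier (on_obj F X)) (carrier (on_obj G X))) \<and>
    (\<forall>X \<in> Obj C. \<forall>Y \<in> Obj C. \<forall>f \<in> carrier (Hom C X Y). \<forall>x \<in> carrier (on_obj F X).
      d Y (on_mor F X Y f x) = on_mor G X Y f (d X x))"

text \<open>Every value of \<open>F\<close> is finite-dimensional and hence injects into the type
  \<open>'v\<close>. Conjugating the morphisms by these injections, chosen separately for each
  object, gives an isomorphic functor that can be an object of the functor categories in
  question.\<close>

lemma linear_functor_transport:
  fixes F :: "('o, 'm, ('k, 'w) module, 'w \<Rightarrow> 'w) cfunctor" and \<iota> :: "'k list \<Rightarrow> 'v"
  assumes C: "category C" and HomC: "\<And>X Y. X \<in> Obj C \<Longrightarrow> Y \<in> Obj C \<Longrightarrow> vectorspace K (Hom C X Y)"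
    and F: "linear_functor K C (Vect K) F" and \<iota>: "inj_on \<iota> (lists (carrier K))"
  shows "\<exists>(G :: ('o, 'm, ('k, 'v) module, 'v \<Rightarrow> 'v) cfunctor) d.
    linear_functor K C (Vect K) G \<and> linear_iso K C G F d"
proof -
  note obj = Vect_functor_obj[OF F]
  have "\<exists>e :: 'w \<Rightarrow> 'v. inj_on e (carrier (on_obj F X))" if "X \<in> Obj C" for X
    by (rule fin_dim_embeds[OF obj[OF that] \<iota>])
  then obtain e :: "'o \<Rightarrow> 'w \<Rightarrow> 'v" where e: "\<And>X. X \<in> Obj C \<Longrightarrow> inj_on (e X) (carrier (on_obj F X))"
    by metis
  define V where "V X = transport (e X) (on_obj F X)" for X
  \<comment> \<open>The comparison points from the copy \<open>G\<close> back to \<open>F\<close>,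
    so that elements of \<open>G X\<close> can be read as elements of \<open>F X\<close>.\<close>
  define d where "d X = inv_into (carrier (on_obj F X)) (e X)" for X
  define G where "G = \<lparr>on_obj = V,
    on_mor = (\<lambda>X Y f. \<lambda>x \<in> carrier (V X). e Y (on_mor F X Y f (d X x)))\<rparr>"
  have V: "vectorspace K (V X)" "vectorspace.fin_dim K (V X)"
    and e_hom: "e X \<in> module_hom K (on_obj F X) (V X)"
    and e_bij: "bij_betw (e X) (carrier (on_obj F X)) (carrier (V X))" if "X \<in> Obj C" for X
    using transport_iso[OF obj[OF that] e[OF that]] unfolding V_def by auto
  have d_hom: "d X \<in> module_hom K (V X) (on_obj F X)"
    and d_bij: "bij_betw (d X) (carrier (V X)) (carrier (on_obj F X))" if "X \<in> Obj C" for X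
    using module_hom_inv_into[OF _ e_hom[OF that] e_bij[OF that]] obj(1)[OF that]
      bij_betw_inv_into[OF e_bij[OF that]] unfolding d_def vectorspace_def by auto
  have ed: "e X (d X x) = x" if "X \<in> Obj C" "x \<in> carrier (V X)" for X x
    using bij_betw_inv_into_right[OF e_bij[OF that(1)] that(2)] unfolding d_def .
  have de: "d X (e X x) = x" if "X \<in> Obj C" "x \<in> carrier (on_obj F X)" for X x
    using bij_betw_inv_into_left[OF e_bij[OF that(1)] that(2)] unfolding d_def .
  have d_mem: "d X x \<in> carrier (on_obj F X)" if "X \<in> Obj C" "x \<in> carrier (V X)" for X x
    by (rule module_hom_mem[OF d_hom[OF that(1)] that(2)])
  have e_mem: "e X x \<in> carrier (V X)" if "X \<in> Obj C" "x \<in> carrier (on_obj F X)" for X x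
    by (rule module_hom_mem[OF e_hom[OF that(1)] that(2)])
  note F_simps = Vect_functor_ident[OF F] Vect_functor_mem[OF F] Vect_functor_add[OF F]
    Vect_functor_smult[OF F] Vect_functor_comp[OF F]
  have G_simps: "on_obj G = V"
    "on_mor G X Y f = (\<lambda>x \<in> carrier (V X). e Y (on_mor F X Y f (d X x)))" for X Y f
    by (simp_all add: G_def)
  have "linear_functor K C (Vect K) G"
  proof (rule linear_functor_VectI[OF _ _ _ _ _ _ _ _ C HomC]; (unfold G_simps)?)
    fix X Y f assume X: "X \<in> Obj C" and Y: "Y \<in> Obj C" and f: "f \<in> carrier (Hom C X Y)"
    have "(\<lambda>x. e Y (on_mor F X Y f (d X x))) \<in> module_hom K (V X) (V Y)"
      using module_hom_comp[OF module_hom_comp[OF d_hom[OF X] Vect_functor_hom[OF F X Y f]] e_hom[OF Y]] .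
    then show "(\<lambda>x \<in> carrier (V X). e Y (on_mor F X Y f (d X x))) \<in> module_hom K (V X) (V Y)"
      using module_hom_restrict V(1)[OF X] unfolding vectorspace_def by blast
  next
    fix X Y f g x
    assume *: "X \<in> Obj C" "Y \<in> Obj C" "f \<in> carrier (Hom C X Y)" "g \<in> carrier (Hom C X Y)"
      "x \<in> carrier (V X)"
    then show "(\<lambda>x\<in>carrier (V X). e Y (on_mor F X Y (f \<oplus>\<^bsub>Hom C X Y\<^esub> g) (d X x))) x =
       (\<lambda>x\<in>carrier (V X). e Y (on_mor F X Y f (d X x))) x \<oplus>\<^bsub>V Y\<^esub>
       (\<lambda>x\<in>carrier (V X). e Y (on_mor F X Y g (d X x))) x"
      by (simp add: F_simps d_mem module_hom_add[OF e_hom])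
  next
    fix X Y a f x
    assume *: "X \<in> Obj C" "Y \<in> Obj C" "a \<in> carrier K" "f \<in> carrier (Hom C X Y)" "x \<in> carrier (V X)"
    then show "(\<lambda>x\<in>carrier (V X). e Y (on_mor F X Y (a \<odot>\<^bsub>Hom C X Y\<^esub> f) (d X x))) x =
       a \<odot>\<^bsub>V Y\<^esub> (\<lambda>x\<in>carrier (V X). e Y (on_mor F X Y f (d X x))) x"
      by (simp add: F_simps d_mem module_hom_smult[OF e_hom])
  qed (simp_all add: V F_simps d_mem e_mem ed de)
  moreover have "linear_iso K C G F d"
    unfolding linear_iso_def G_simps by (auto simp: d_hom d_bij F_simps d_mem de)
  ultimately show ?thesis
    by blast
qed

section \<open>The Yoneda lemma\<close>

text \<open>Composition is bilinear, stated one argument at a time. Finite-dimensional spaces of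
  morphisms ensure that representable functors and their duals take values in
  \<open>Vect K\<close>.\<close>

locale linear_category = category C for K :: "'k ring" and C :: "('k, 'o, 'm) lin_cat" +
  assumes Hom_vectorspace: "X \<in> Obj C \<Longrightarrow> Y \<in> Obj C \<Longrightarrow> vectorspace K (Hom C X Y)"
    and Hom_fin_dim: "X \<in> Obj C \<Longrightarrow> Y \<in> Obj C \<Longrightarrow> vectorspace.fin_dim K (Hom C X Y)"
    and precomp_hom: "\<lbrakk>X \<in> Obj C; Y \<in> Obj C; Z \<in> Obj C; f \<in> carrier (Hom C X Y)\<rbrakk> \<Longrightarrow>
      (\<lambda>g. Comp C X Y Z g f) \<in> module_hom K (Hom C Y Z) (Hom C X Z)"
    and postcomp_hom: "\<lbrakk>X \<in> Obj C; Y \<in> Obj C; Z \<in> Obj C; g \<in> carrier (Hom C Y Z)\<rbrakk> \<Longrightarrow>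
      (\<lambda>f. Comp C X Y Z g f) \<in> module_hom K (Hom C X Y) (Hom C X Z)"
begin

lemma Hom_module: "X \<in> Obj C \<Longrightarrow> Y \<in> Obj C \<Longrightarrow> module K (Hom C X Y)"
  using Hom_vectorspace unfolding vectorspace_def by blast

definition hom_functor :: "'o \<Rightarrow> ('o, 'm, ('k, 'm) module, 'm \<Rightarrow> 'm) cfunctor" where
  "hom_functor N = \<lparr>on_obj = Hom C N,
    on_mor = (\<lambda>X Y f. \<lambda>g \<in> carrier (Hom C N X). Comp C N X Y f g)\<rparr>"

lemma hom_functor_simps:
  "on_obj (hom_functor N) X = Hom C N X"
  "on_mor (hom_functor N) X Y f = (\<lambda>g \<in> carrier (Hom C N X). Comp C N X Y f g)"
  by (simp_all add: hom_functor_def)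

text \<open>The linearity of postcomposition makes each induced map linear; that of precomposition
  makes the functor itself linear on morphisms.\<close>

lemma linear_hom_functor:
  assumes N: "N \<in> Obj C"
  shows "linear_functor K C (Vect K) (hom_functor N)"
proof (rule linear_functor_VectI[OF _ _ _ _ _ _ _ _ category_axioms Hom_vectorspace];
    (unfold hom_functor_simps)?)
  fix X Y f assume *: "X \<in> Obj C" "Y \<in> Obj C" "f \<in> carrier (Hom C X Y)"
  then show "restrict (Comp C N X Y f) (carrier (Hom C N X)) \<in> module_hom K (Hom C N X) (Hom C N Y)"
    using postcomp_hom[OF N *] module_hom_restrict[OF Hom_module[OF N *(1)]] by blast
next
  fix X Y f g x
  assume *: "X \<in> Obj C" "Y \<in> Obj C" "f \<in> carrier (Hom C X Y)" "g \<in> carrier (Hom C X Y)"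
    "x \<in> carrier (Hom C N X)"
  then show "(\<lambda>x\<in>carrier (Hom C N X). Comp C N X Y (f \<oplus>\<^bsub>Hom C X Y\<^esub> g) x) x =
      (\<lambda>x\<in>carrier (Hom C N X). Comp C N X Y f x) x \<oplus>\<^bsub>Hom C N Y\<^esub>
      (\<lambda>x\<in>carrier (Hom C N X). Comp C N X Y g x) x"
    using module_hom_add[OF precomp_hom[OF N *(1,2,5)] *(3,4)] by simp
next
  fix X Y a f x
  assume *: "X \<in> Obj C" "Y \<in> Obj C" "a \<in> carrier K" "f \<in> carrier (Hom C X Y)"
    "x \<in> carrier (Hom C N X)"
  then show "(\<lambda>x\<in>carrier (Hom C N X). Comp C N X Y (a \<odot>\<^bsub>Hom C X Y\<^esub> f) x) x =
      a \<odot>\<^bsub>Hom C N Y\<^esub> (\<lambda>x\<in>carrier (Hom C N X). Comp C N X Y f x) x"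
    using module_hom_smult[OF precomp_hom[OF N *(1,2,5)] *(3,4)] by simp
qed (simp_all add: N Hom_vectorspace Hom_fin_dim comp ident_comp comp_assoc)

text \<open>This is covariant in \<open>X\<close>, being contravariant twice. It is the dual
  counterpart of a representable functor: natural transformations from \<open>G\<close> into it
  correspond to linear maps from \<open>G N\<close> to \<open>E\<close>.\<close>

definition dual_hom_functor ::
  "'o \<Rightarrow> ('k, 'v) module \<Rightarrow> ('o, 'm, ('k, 'm \<Rightarrow> 'v) module, ('m \<Rightarrow> 'v) \<Rightarrow> 'm \<Rightarrow> 'v) cfunctor" where
  "dual_hom_functor N E = \<lparr>on_obj = (\<lambda>X. lin_maps K (Hom C X N) E),
    on_mor = (\<lambda>X Y f. \<lambda>\<phi> \<in> carrier (lin_maps K (Hom C X N) E).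
      \<lambda>g \<in> carrier (Hom C Y N). \<phi> (Comp C X Y N g f))\<rparr>"

lemma dual_hom_functor_simps:
  "on_obj (dual_hom_functor N E) X = lin_maps K (Hom C X N) E"
  "on_mor (dual_hom_functor N E) X Y f = (\<lambda>\<phi> \<in> carrier (lin_maps K (Hom C X N) E).
    \<lambda>g \<in> carrier (Hom C Y N). \<phi> (Comp C X Y N g f))"
  by (simp_all add: dual_hom_functor_def)

text \<open>Compared with \<open>hom_functor\<close> the two linearity laws exchange roles:
  precomposition keeps functionals linear, and postcomposition gives linearity in the morphism
  \<open>f\<close>.\<close>

lemma linear_dual_hom_functor:
  assumes N: "N \<in> Obj C" and E: "vectorspace K E" "vectorspace.fin_dim K E"
  shows "linear_functor K C (Vect K) (dual_hom_functor N E)"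
proof (rule linear_functor_VectI[OF _ _ _ _ _ _ _ _ category_axioms Hom_vectorspace];
    (unfold dual_hom_functor_simps)?)
  let ?D = "\<lambda>X. lin_maps K (Hom C X N) E"
  note restr = module_hom_restrict[OF Hom_module[OF _ N]]
  have mod: "module K (?D X)" if "X \<in> Obj C" for X
    using vectorspace_lin_maps[OF Hom_vectorspace[OF that N] E(1)] unfolding vectorspace_def by blast
  fix X Y f assume X: "X \<in> Obj C" and Y: "Y \<in> Obj C" and f: "f \<in> carrier (Hom C X Y)"
  have mem: "(\<lambda>g \<in> carrier (Hom C Y N). \<phi> (Comp C X Y N g f)) \<in> carrier (?D Y)"
    if "\<phi> \<in> carrier (?D X)" for \<phi>
    using module_hom_comp[OF precomp_hom[OF X Y N f], of \<phi> E] that by (simp add: restr[OF Y])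
  have "(\<lambda>\<phi>. \<lambda>g \<in> carrier (Hom C Y N). \<phi> (Comp C X Y N g f)) \<in> module_hom K (?D X) (?D Y)"
    unfolding module_hom_def using mem
    by (auto intro!: restrict_ext simp: comp[OF X Y N f] simp del: lin_maps_simps(1))
  then show "(\<lambda>\<phi> \<in> carrier (?D X). \<lambda>g \<in> carrier (Hom C Y N). \<phi> (Comp C X Y N g f))
      \<in> module_hom K (?D X) (?D Y)"
    using module_hom_restrict[OF mod[OF X]] by blast
next
  let ?D = "\<lambda>X. lin_maps K (Hom C X N) E"
  fix X Y Z f g \<phi>
  assume *: "X \<in> Obj C" "Y \<in> Obj C" "Z \<in> Obj C" "f \<in> carrier (Hom C X Y)" "g \<in> carrier (Hom C Y Z)"
    and \<phi>: "\<phi> \<in> carrier (?D X)"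
  \<comment> \<open>The map for \<open>g\<close> is cut off outside \<open>?D Y\<close>, so it can
    be unfolded only once its argument is known to lie there.\<close>
  have "(\<lambda>h \<in> carrier (Hom C Y N). \<phi> (Comp C X Y N h f)) \<in> carrier (?D Y)"
    using module_hom_comp[OF precomp_hom[OF *(1,2) N *(4)], of \<phi> E] \<phi>
    by (simp add: module_hom_restrict[OF Hom_module[OF *(2) N]])
  then show "(\<lambda>\<phi> \<in> carrier (?D X). \<lambda>h \<in> carrier (Hom C Z N). \<phi> (Comp C X Z N h (Comp C X Y Z g f))) \<phi> =
      (\<lambda>\<phi> \<in> carrier (?D Y). \<lambda>h \<in> carrier (Hom C Z N). \<phi> (Comp C Y Z N h g))
        ((\<lambda>\<phi> \<in> carrier (?D X). \<lambda>h \<in> carrier (Hom C Y N). \<phi> (Comp C X Y N h f)) \<phi>)"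
    using * \<phi> by (auto intro!: restrict_ext simp: N comp comp_assoc simp del: lin_maps_simps(1))
next
  let ?D = "\<lambda>X. lin_maps K (Hom C X N) E"
  fix X Y f f' \<phi>
  assume *: "X \<in> Obj C" "Y \<in> Obj C" "f \<in> carrier (Hom C X Y)" "f' \<in> carrier (Hom C X Y)"
    and \<phi>: "\<phi> \<in> carrier (?D X)"
  have "\<phi> (Comp C X Y N g (f \<oplus>\<^bsub>Hom C X Y\<^esub> f')) = \<phi> (Comp C X Y N g f) \<oplus>\<^bsub>E\<^esub> \<phi> (Comp C X Y N g f')"
    if g: "g \<in> carrier (Hom C Y N)" for g
    using \<phi> module_hom_add[OF postcomp_hom[OF *(1,2) N g] *(3,4)]
      module_hom_add[of \<phi> K "Hom C X N" E] by (simp add: * N g comp)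
  then show "(\<lambda>\<phi> \<in> carrier (?D X). \<lambda>h \<in> carrier (Hom C Y N). \<phi> (Comp C X Y N h (f \<oplus>\<^bsub>Hom C X Y\<^esub> f'))) \<phi> =
      (\<lambda>\<phi> \<in> carrier (?D X). \<lambda>h \<in> carrier (Hom C Y N). \<phi> (Comp C X Y N h f)) \<phi> \<oplus>\<^bsub>?D Y\<^esub>
      (\<lambda>\<phi> \<in> carrier (?D X). \<lambda>h \<in> carrier (Hom C Y N). \<phi> (Comp C X Y N h f')) \<phi>"
    using \<phi> by (auto intro!: restrict_ext simp del: lin_maps_simps(1))
next
  let ?D = "\<lambda>X. lin_maps K (Hom C X N) E"
  fix X Y a f \<phi>
  assume *: "X \<in> Obj C" "Y \<in> Obj C" "a \<in> carrier K" "f \<in> carrier (Hom C X Y)"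
    and \<phi>: "\<phi> \<in> carrier (?D X)"
  have "\<phi> (Comp C X Y N g (a \<odot>\<^bsub>Hom C X Y\<^esub> f)) = a \<odot>\<^bsub>E\<^esub> \<phi> (Comp C X Y N g f)"
    if g: "g \<in> carrier (Hom C Y N)" for g
    using \<phi> module_hom_smult[OF postcomp_hom[OF *(1,2) N g] *(3,4)]
      module_hom_smult[of \<phi> K "Hom C X N" E] by (simp add: * N g comp)
  then show "(\<lambda>\<phi> \<in> carrier (?D X). \<lambda>h \<in> carrier (Hom C Y N). \<phi> (Comp C X Y N h (a \<odot>\<^bsub>Hom C X Y\<^esub> f))) \<phi> =
      a \<odot>\<^bsub>?D Y\<^esub> (\<lambda>\<phi> \<in> carrier (?D X). \<lambda>h \<in> carrier (Hom C Y N). \<phi> (Comp C X Y N h f)) \<phi>"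
    using \<phi> by (auto intro!: restrict_ext simp del: lin_maps_simps(1))
next
  fix X \<phi> assume X: "X \<in> Obj C" and \<phi>: "\<phi> \<in> carrier (lin_maps K (Hom C X N) E)"
  have "(\<lambda>g \<in> carrier (Hom C X N). \<phi> (Comp C X X N g (Ident C X))) = \<phi>"
    using \<phi> by (intro restrict_eqI) (simp_all add: comp_ident X N)
  then show "(\<lambda>\<phi> \<in> carrier (lin_maps K (Hom C X N) E). \<lambda>g \<in> carrier (Hom C X N).
      \<phi> (Comp C X X N g (Ident C X))) \<phi> = \<phi>"
    using \<phi> by (simp del: lin_maps_simps(1))
qed (simp_all add: N E Hom_vectorspace Hom_fin_dim vectorspace_lin_maps fin_dim_lin_maps)

text \<open>\<open>H\<close> is a copy of the functor represented by \<open>N\<close>, read through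
  \<open>d\<close>. Naturality is functoriality of \<open>G\<close>, and linearity of the components
  is linearity of \<open>G\<close> on morphisms. The inverse passage, evaluation at the identity, is
  made where the lemma is applied.\<close>

lemma yoneda:
  assumes N: "N \<in> Obj C" and H: "linear_functor K C (Vect K) H"
    and d: "linear_iso K C H (hom_functor N) d"
    and G: "linear_functor K C (Vect K) G" and x: "x \<in> carrier (on_obj G N)"
  shows "(\<lambda>X \<in> Obj C. \<lambda>z \<in> carrier (on_obj H X). on_mor G N X (d X z) x) \<in>
    carrier (Hom (functor_cat K C (Vect K)) H G)"
proof -
  have d_hom: "d X \<in> module_hom K (on_obj H X) (Hom C N X)" if "X \<in> Obj C" for X
    using d that unfolding linear_iso_def hom_functor_simps by blast
  have d_mem: "d X z \<in> carrier (Hom C N X)" if "X \<in> Obj C" "z \<in> carrier (on_obj H X)" for X z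
    by (rule module_hom_mem[OF d_hom[OF that(1)] that(2)])
  have d_nat: "d Y (on_mor H X Y f z) = Comp C N X Y f (d X z)"
    if "X \<in> Obj C" "Y \<in> Obj C" "f \<in> carrier (Hom C X Y)" "z \<in> carrier (on_obj H X)" for X Y f z
    using d that d_mem[OF that(1,4)] unfolding linear_iso_def hom_functor_simps by simp
  have "(\<lambda>z. on_mor G N X (d X z) x) \<in> module_hom K (on_obj H X) (on_obj G X)" if X: "X \<in> Obj C" for X
    unfolding module_hom_def
    by (simp add: module_hom_add[OF d_hom[OF X]] module_hom_smult[OF d_hom[OF X]] d_mem[OF X]
      Vect_functor_mem[OF G N X _ x] Vect_functor_add[OF G N X _ x] Vect_functor_smult[OF G N X _ x])
  moreover have "on_mor G N Y (d Y (on_mor H X Y f z)) x = on_mor G X Y f (on_mor G N X (d X z) x)"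
    if "X \<in> Obj C" "Y \<in> Obj C" "f \<in> carrier (Hom C X Y)" "z \<in> carrier (on_obj H X)" for X Y f z
    using d_nat[OF that] Vect_functor_comp[OF G N that(1) d_mem[OF that(1,4)] x that(2,3)] by simp
  ultimately show ?thesis
    by (intro Vect_nat_transfI H)
qed

text \<open>An element \<open>x\<close> of \<open>G X\<close> gives the functional that pushes
  \<open>x\<close> along \<open>g\<close> to \<open>G N\<close> and then applies \<open>p\<close>.
  The transformation into the copy \<open>H\<close> involves the inverse of \<open>d\<close>, so it
  is characterized by what \<open>d\<close> makes of it; evaluation at the identity of
  \<open>N\<close> returns \<open>p\<close>.\<close>

lemma coyoneda:
  assumes N: "N \<in> Obj C" and H: "linear_functor K C (Vect K) H"
    and d: "linear_iso K C H (dual_hom_functor N E) d" and E: "vectorspace K E"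
    and G: "linear_functor K C (Vect K) G" and p: "p \<in> module_hom K (on_obj G N) E"
  obtains \<alpha> where "\<alpha> \<in> carrier (Hom (functor_cat K C (Vect K)) G H)"
    and "\<And>X x. X \<in> Obj C \<Longrightarrow> x \<in> carrier (on_obj G X) \<Longrightarrow>
      d X (\<alpha> X x) = (\<lambda>g \<in> carrier (Hom C X N). p (on_mor G X N g x))"
proof -
  let ?D = "\<lambda>X. lin_maps K (Hom C X N) E"
  define t where "t X x = (\<lambda>g \<in> carrier (Hom C X N). p (on_mor G X N g x))" for X x
  define e where "e X = inv_into (carrier (on_obj H X)) (d X)" for X
  have d_hom: "d X \<in> module_hom K (on_obj H X) (?D X)"
    and d_bij: "bij_betw (d X) (carrier (on_obj H X)) (carrier (?D X))" if "X \<in> Obj C" for X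
    using d that unfolding linear_iso_def dual_hom_functor_simps by blast+
  have d_mem: "d X z \<in> carrier (?D X)" if "X \<in> Obj C" "z \<in> carrier (on_obj H X)" for X z
    by (rule module_hom_mem[OF d_hom[OF that(1)] that(2)])
  have d_nat: "d Y (on_mor H X Y f z) = (\<lambda>g \<in> carrier (Hom C Y N). d X z (Comp C X Y N g f))"
    if "X \<in> Obj C" "Y \<in> Obj C" "f \<in> carrier (Hom C X Y)" "z \<in> carrier (on_obj H X)" for X Y f z
    using d that d_mem[OF that(1,4)] unfolding linear_iso_def dual_hom_functor_simps
    by (simp del: lin_maps_simps(1))
  have e_hom: "e X \<in> module_hom K (?D X) (on_obj H X)" if "X \<in> Obj C" for X
    using module_hom_inv_into[OF _ d_hom[OF that] d_bij[OF that]] Vect_functor_obj(1)[OF H that]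
    unfolding e_def vectorspace_def by blast
  have de: "d X (e X \<phi>) = \<phi>" if "X \<in> Obj C" "\<phi> \<in> carrier (?D X)" for X \<phi>
    using bij_betw_inv_into_right[OF d_bij[OF that(1)] that(2)] unfolding e_def .
  have ed: "e X (d X z) = z" if "X \<in> Obj C" "z \<in> carrier (on_obj H X)" for X z
    using bij_betw_inv_into_left[OF d_bij[OF that(1)] that(2)] unfolding e_def .
  have e_mem: "e X \<phi> \<in> carrier (on_obj H X)" if "X \<in> Obj C" "\<phi> \<in> carrier (?D X)" for X \<phi>
    by (rule module_hom_mem[OF e_hom[OF that(1)] that(2)])
  \<comment> \<open>Linearity in \<open>g\<close> comes from the linearity of \<open>G\<close> on
    morphisms; \<open>t_hom\<close> is linearity in \<open>x\<close> and comes from that of each map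
    \<open>on_mor G X N g\<close>.\<close>
  have t_mem: "t X x \<in> carrier (?D X)" if X: "X \<in> Obj C" and x: "x \<in> carrier (on_obj G X)" for X x
  proof -
    have "(\<lambda>g. on_mor G X N g x) \<in> module_hom K (Hom C X N) (on_obj G N)"
      unfolding module_hom_def by (simp add: Vect_functor_mem[OF G X N _ x]
        Vect_functor_add[OF G X N _ x] Vect_functor_smult[OF G X N _ x])
    from module_hom_comp[OF this p] show ?thesis
      by (simp add: t_def module_hom_restrict[OF Hom_module[OF X N]])
  qed
  have t_hom: "t X \<in> module_hom K (on_obj G X) (?D X)" if X: "X \<in> Obj C" for X
  proof -
    have "p (on_mor G X N g (x \<oplus>\<^bsub>on_obj G X\<^esub> y)) = p (on_mor G X N g x) \<oplus>\<^bsub>E\<^esub> p (on_mor G X N g y)"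
      if "x \<in> carrier (on_obj G X)" "y \<in> carrier (on_obj G X)" "g \<in> carrier (Hom C X N)" for x y g
      using that module_hom_add[OF Vect_functor_hom[OF G X N that(3)] that(1,2)]
      by (simp add: module_hom_add[OF p] Vect_functor_mem[OF G X N])
    moreover have "p (on_mor G X N g (a \<odot>\<^bsub>on_obj G X\<^esub> x)) = a \<odot>\<^bsub>E\<^esub> p (on_mor G X N g x)"
      if "x \<in> carrier (on_obj G X)" "a \<in> carrier K" "g \<in> carrier (Hom C X N)" for x a g
      using that module_hom_smult[OF Vect_functor_hom[OF G X N that(3)] that(2,1)]
      by (simp add: module_hom_smult[OF p] Vect_functor_mem[OF G X N])
    ultimately show ?thesis
      unfolding module_hom_def using t_mem[OF X]
      by (auto simp: t_def intro!: restrict_ext simp del: lin_maps_simps(1))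
  qed
  let ?\<alpha> = "\<lambda>X \<in> Obj C. \<lambda>x \<in> carrier (on_obj G X). e X (t X x)"
  have "e Y (t Y (on_mor G X Y f x)) = on_mor H X Y f (e X (t X x))"
    if X: "X \<in> Obj C" and Y: "Y \<in> Obj C" and f: "f \<in> carrier (Hom C X Y)"
      and x: "x \<in> carrier (on_obj G X)" for X Y f x
  proof -
    \<comment> \<open>The square is checked after \<open>d Y\<close>, where the naturality of
      \<open>d\<close> turns it into functoriality of \<open>G\<close>; applying \<open>e Y\<close>
      then undoes \<open>d Y\<close>.\<close>
    have "d Y (on_mor H X Y f (e X (t X x))) = t Y (on_mor G X Y f x)"
      unfolding d_nat[OF X Y f e_mem[OF X t_mem[OF X x]]] de[OF X t_mem[OF X x]]
      unfolding t_def by (rule restrict_ext)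
        (simp add: comp[OF X Y N f] Vect_functor_comp[OF G X Y f x N])
    then show ?thesis
      using ed[OF Y Vect_functor_mem[OF H X Y f e_mem[OF X t_mem[OF X x]]]] by simp
  qed
  then have "?\<alpha> \<in> carrier (Hom (functor_cat K C (Vect K)) G H)"
    using module_hom_comp[OF t_hom e_hom] by (intro Vect_nat_transfI G)
  moreover have "d X (?\<alpha> X x) = t X x" if "X \<in> Obj C" "x \<in> carrier (on_obj G X)" for X x
    using that de[OF that(1) t_mem[OF that]] by simp
  ultimately show ?thesis
    using that unfolding t_def by blast
qed

end

section \<open>Kan extension along a full embedding\<close>

text \<open>The spaces of morphisms of \<open>B\<close> are literally those of \<open>C\<close>
  between the images, and \<open>j\<close> is the identity on them. Full faithfulness thus holds by
  equality, with no comparison map to carry along.\<close>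

locale full_embedding = C: linear_category K C
  for K :: "'k ring" and C :: "('k, 'o1, 'm) lin_cat" +
  fixes B :: "('k, 'o0, 'm) lin_cat" and j :: "('o0, 'm, 'o1, 'm) cfunctor"
  assumes obj: "X \<in> Obj B \<Longrightarrow> on_obj j X \<in> Obj C"
    and Hom_eq: "X \<in> Obj B \<Longrightarrow> Y \<in> Obj B \<Longrightarrow> Hom B X Y = Hom C (on_obj j X) (on_obj j Y)"
    and Ident_eq: "X \<in> Obj B \<Longrightarrow> Ident B X = Ident C (on_obj j X)"
    and Comp_eq: "X \<in> Obj B \<Longrightarrow> Y \<in> Obj B \<Longrightarrow> Z \<in> Obj B \<Longrightarrow>
      Comp B X Y Z = Comp C (on_obj j X) (on_obj j Y) (on_obj j Z)"
    and mor: "on_mor j X Y f = f"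
begin

sublocale B: linear_category K B
  by (intro linear_category.intro category.intro linear_category_axioms.intro)
    (simp_all add: obj Hom_eq Ident_eq Comp_eq C.ident C.comp C.comp_ident C.ident_comp C.comp_assoc
      C.Hom_vectorspace C.Hom_fin_dim C.precomp_hom C.postcomp_hom)

lemma linear_comp_functor:
  assumes F: "linear_functor K C (Vect K) F"
  shows "linear_functor K B (Vect K) (comp_functor F j)"
  by (rule linear_functor_VectI[OF _ _ _ _ _ _ _ _ B.category_axioms B.Hom_vectorspace])
    (simp_all add: obj Hom_eq Ident_eq Comp_eq mor Vect_functor_obj[OF F] Vect_functor_hom[OF F]
      Vect_functor_ext[OF F] Vect_functor_ident[OF F] Vect_functor_comp[OF F] Vect_functor_add[OF F]
      Vect_functor_smult[OF F])

text \<open>This is where fullness enters: restricting the functor represented by \<open>j N\<close>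
  gives the functor represented by \<open>N\<close>. Hence \<open>yoneda\<close> applies over
  \<open>B\<close> and over \<open>C\<close> with the same \<open>H\<close> and
  \<open>d\<close>.\<close>

lemma hom_functor_restrict:
  assumes "N \<in> Obj B" and "linear_iso K C H (C.hom_functor (on_obj j N)) d"
  shows "linear_iso K B (comp_functor H j) (B.hom_functor N) (\<lambda>X. d (on_obj j X))"
  using assms unfolding linear_iso_def
  by (simp add: B.hom_functor_simps C.hom_functor_simps obj Hom_eq Comp_eq mor)

lemma dual_hom_functor_restrict:
  assumes "N \<in> Obj B" and "linear_iso K C H (C.dual_hom_functor (on_obj j N) E) d"
  shows "linear_iso K B (comp_functor H j) (B.dual_hom_functor N E) (\<lambda>X. d (on_obj j X))"
  using assms unfolding linear_iso_def
  by (simp add: B.dual_hom_functor_simps C.dual_hom_functor_simps obj Hom_eq Comp_eq mor)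

abbreviation "AC \<equiv> functor_cat K C (Vect K)"
abbreviation "PB \<equiv> functor_cat K B (Vect K)"

text \<open>It suffices that every component is bijective. Both halves test against a copy
  \<open>H\<close> of the functor represented by \<open>j V\<close>: \<open>counit_factor\<close>
  gives surjectivity, \<open>counit_cancel\<close> injectivity.\<close>

lemma counit_iso:
  fixes R :: "(('o0, 'm, ('k, 'v) module, 'v \<Rightarrow> 'v) cfunctor, 'o0 \<Rightarrow> 'v \<Rightarrow> 'v,
    ('o1, 'm, ('k, 'v) module, 'v \<Rightarrow> 'v) cfunctor, 'o1 \<Rightarrow> 'v \<Rightarrow> 'v) cfunctor"
    and \<iota> :: "'k list \<Rightarrow> 'v"
  assumes adj: "adjunction AC PB (precomp B j) R \<eta> \<epsilon>" and \<iota>: "inj_on \<iota> (lists (carrier K))"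
  shows "nat_iso PB PB (comp_functor (precomp B j) R) id_functor \<epsilon>"
proof -
  interpret adj: adjoint_pair AC PB "precomp B j" R \<eta> \<epsilon>
    by (intro adjoint_pair.intro adjoint_pair_axioms.intro category_functor_cat category_Vect adj)
  have "is_iso PB (comp_functor (on_obj R F) j) F (\<epsilon> F)" if F: "F \<in> Obj PB" for F
  proof -
    define G where "G = on_obj R F"
    have linF: "linear_functor K B (Vect K) F"
      using F by simp
    have linG: "linear_functor K C (Vect K) G"
      using adj.R_obj[OF F] by (simp add: G_def)
    note linGj = linear_comp_functor[OF linG]
    have \<epsilon>F: "\<epsilon> F \<in> carrier (Hom PB (comp_functor G j) F)"
      using adj.\<epsilon>_mor[OF F] by (simp only: precomp_simps G_def)
    have "bij_betw (\<epsilon> F V) (carrier (on_obj G (on_obj j V))) (carrier (on_obj F V))"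
      if V: "V \<in> Obj B" for V
    proof -
      let ?N = "on_obj j V"
      have N: "?N \<in> Obj C"
        by (rule obj[OF V])
      obtain H :: "('o1, 'm, ('k, 'v) module, 'v \<Rightarrow> 'v) cfunctor" and d
        where H: "linear_functor K C (Vect K) H" and d: "linear_iso K C H (C.hom_functor ?N) d"
        using linear_functor_transport[OF C.category_axioms C.Hom_vectorspace C.linear_hom_functor[OF N] \<iota>]
        by blast
      have HO: "H \<in> Obj AC" using H by simp
      note Hj = linear_comp_functor[OF H] and dj = hom_functor_restrict[OF V d]
      have d_bij: "bij_betw (d X) (carrier (on_obj H X)) (carrier (Hom C ?N X))"
        if "X \<in> Obj C" for X
        using d that unfolding linear_iso_def C.hom_functor_simps by blast
      \<comment> \<open>\<open>z1\<close> is the universal element of \<open>H\<close>: a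
        transformation built by \<open>yoneda\<close> from \<open>u\<close> sends it back to
        \<open>u\<close>.\<close>
      obtain z1 where z1: "z1 \<in> carrier (on_obj H ?N)" "d ?N z1 = Ident C ?N"
        using d_bij[OF N] C.ident[OF N] unfolding bij_betw_def by (metis imageE)
      have "y \<in> \<epsilon> F V ` carrier (on_obj G ?N)" if y: "y \<in> carrier (on_obj F V)" for y
      proof -
        \<comment> \<open>The transformation over \<open>B\<close> that belongs to \<open>y\<close>.
          Its transpose \<beta> goes from \<open>H\<close> to \<open>G\<close>, and the value of
          \<beta> at \<open>z1\<close> is the preimage sought.\<close>
        let ?\<alpha> = "\<lambda>X \<in> Obj B. \<lambda>z \<in> carrier (on_obj (comp_functor H j) X).
          on_mor F V X (d (on_obj j X) z) y"
        have "?\<alpha> \<in> carrier (Hom PB (on_obj (precomp B j) H) F)"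
          unfolding precomp_simps by (rule B.yoneda[OF V Hj dj linF y])
        from adj.counit_factor[OF HO F this] obtain \<beta>
          where \<beta>: "\<beta> \<in> carrier (Hom AC H G)"
            and eq: "Comp PB (comp_functor H j) (comp_functor G j) F (\<epsilon> F) (\<lambda>X \<in> Obj B. \<beta> (on_obj j X)) = ?\<alpha>"
          unfolding precomp_simps G_def by blast
        have "\<epsilon> F V (\<beta> ?N z1) = ?\<alpha> V z1"
          using fun_cong[OF fun_cong[OF eq, of V], of z1] V z1(1) by (simp add: compose_def)
        also have "\<dots> = y"
          using V z1 Vect_functor_ident[OF linF V y] by (simp add: Ident_eq)
        finally show ?thesis
          using Vect_nat_transf_mem[OF \<beta> N z1(1)] by blast
      qed
      moreover have "\<epsilon> F V x \<in> carrier (on_obj F V)" if "x \<in> carrier (on_obj G ?N)" for x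
        using Vect_nat_transf_mem[OF \<epsilon>F V] that by simp
      moreover have "x = x'"
        if x: "x \<in> carrier (on_obj G ?N)" "x' \<in> carrier (on_obj G ?N)"
          and eq: "\<epsilon> F V x = \<epsilon> F V x'" for x x'
      proof -
        define \<beta> where "\<beta> u = (\<lambda>X \<in> Obj C. \<lambda>z \<in> carrier (on_obj H X). on_mor G ?N X (d X z) u)" for u
        have \<beta>: "\<beta> u \<in> carrier (Hom AC H G)" if "u \<in> carrier (on_obj G ?N)" for u
          unfolding \<beta>_def by (rule C.yoneda[OF N H d linG that])
        \<comment> \<open>By naturality of the counit, the transpose of \<open>\<beta> u\<close>
          depends on \<open>u\<close> only through \<open>\<epsilon> F V u\<close>. Elements with
          equal images therefore have equal transposes.\<close>
        have comp_\<beta>: "Comp PB (comp_functor H j) (comp_functor G j) F (\<epsilon> F)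
            (\<lambda>X \<in> Obj B. \<beta> u (on_obj j X)) =
          (\<lambda>X \<in> Obj B. \<lambda>z \<in> carrier (on_obj H (on_obj j X)).
            on_mor F V X (d (on_obj j X) z) (\<epsilon> F V u))"
          if u: "u \<in> carrier (on_obj G ?N)" for u
        proof -
          have "\<epsilon> F X (on_mor G ?N (on_obj j X) (d (on_obj j X) z) u) =
              on_mor F V X (d (on_obj j X) z) (\<epsilon> F V u)"
            if X: "X \<in> Obj B" and z: "z \<in> carrier (on_obj H (on_obj j X))" for X z
          proof -
            have "d (on_obj j X) z \<in> carrier (Hom B V X)"
              using bij_betwE[OF d_bij[OF obj[OF X]]] z by (simp add: Hom_eq V X)
            then show ?thesis
              using Vect_nat_transf_natural[OF \<epsilon>F V _ X] u by (simp add: mor)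
          qed
          then show ?thesis
            unfolding functor_cat_simps Vect_simps
            by (auto simp: \<beta>_def compose_def obj intro!: restrict_ext)
        qed
        have "\<beta> x = \<beta> x'"
        proof (rule adj.counit_cancel[OF HO F])
          show "\<beta> x \<in> carrier (Hom AC H (on_obj R F))" "\<beta> x' \<in> carrier (Hom AC H (on_obj R F))"
            using \<beta> x unfolding G_def by auto
        qed (simp only: precomp_simps comp_\<beta>[unfolded G_def] x[unfolded G_def] eq)
        then have "\<beta> x ?N z1 = \<beta> x' ?N z1"
          by simp
        then show ?thesis
          using N z1 x Vect_functor_ident[OF linG N] by (simp add: \<beta>_def)
      qed
      ultimately show ?thesis
        by (intro bij_betw_imageI inj_onI) auto
    qed
    then have "is_iso (Vect K) (on_obj (comp_functor G j) V) (on_obj F V) (\<epsilon> F V)"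
      if V: "V \<in> Obj B" for V
      using Vect_functor_obj(1)[OF linGj V] Vect_functor_obj(1)[OF linF V] V
        Vect_nat_transf_mor[OF \<epsilon>F V]
      by (intro is_iso_Vect) simp_all
    then show ?thesis
      using is_iso_functor_cat[OF category_Vect linGj linF \<epsilon>F] unfolding G_def by blast
  qed
  then show ?thesis
    unfolding nat_iso_def using adj.\<epsilon>_nat by (simp add: precomp_simps)
qed

text \<open>Only maps out of \<open>G\<close> are controlled by the adjunction, so \<open>G\<close>
  is probed by copies of \<open>dual_hom_functor\<close>, into which transformations are known from
  \<open>coyoneda\<close>. The two choices of \<open>E\<close> yield a left inverse \<open>p\<close>
  of the unit component and then show that it is a right inverse.\<close>

lemma unit_iso:
  fixes L :: "(('o0, 'm, ('k, 'v) module, 'v \<Rightarrow> 'v) cfunctor, 'o0 \<Rightarrow> 'v \<Rightarrow> 'v,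
    ('o1, 'm, ('k, 'v) module, 'v \<Rightarrow> 'v) cfunctor, 'o1 \<Rightarrow> 'v \<Rightarrow> 'v) cfunctor"
    and \<iota> :: "'k list \<Rightarrow> 'v"
  assumes adj: "adjunction PB AC L (precomp B j) \<eta> \<epsilon>" and \<iota>: "inj_on \<iota> (lists (carrier K))"
  shows "nat_iso PB PB id_functor (comp_functor (precomp B j) L) \<eta>"
proof -
  interpret adj: adjoint_pair PB AC L "precomp B j" \<eta> \<epsilon>
    by (intro adjoint_pair.intro adjoint_pair_axioms.intro category_functor_cat category_Vect adj)
  have "is_iso PB F (comp_functor (on_obj L F) j) (\<eta> F)" if F: "F \<in> Obj PB" for F
  proof -
    define G where "G = on_obj L F"
    have linF: "linear_functor K B (Vect K) F"
      using F by simp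
    have linG: "linear_functor K C (Vect K) G"
      using adj.L_obj[OF F] by (simp add: G_def)
    note linGj = linear_comp_functor[OF linG]
    have \<eta>F: "\<eta> F \<in> carrier (Hom PB F (comp_functor G j))"
      using adj.\<eta>_mor[OF F] by (simp only: precomp_simps G_def)
    have "bij_betw (\<eta> F V) (carrier (on_obj F V)) (carrier (on_obj G (on_obj j V)))"
      if V: "V \<in> Obj B" for V
    proof -
      let ?N = "on_obj j V"
      have N: "?N \<in> Obj C"
        by (rule obj[OF V])
      have \<eta>_hom: "\<eta> F V \<in> module_hom K (on_obj F V) (on_obj G ?N)"
        using Vect_nat_transf_hom[OF \<eta>F V] by simp
      have \<eta>_mem: "\<eta> F X x \<in> carrier (on_obj G (on_obj j X))"
        if "X \<in> Obj B" "x \<in> carrier (on_obj F X)" for X x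
        using Vect_nat_transf_mem[OF \<eta>F that] by simp
      have \<eta>_natural: "on_mor G (on_obj j X) ?N g (\<eta> F X x) = \<eta> F V (on_mor F X V g x)"
        if "X \<in> Obj B" "x \<in> carrier (on_obj F X)" "g \<in> carrier (Hom B X V)" for X x g
        using Vect_nat_transf_natural[OF \<eta>F that(1,2) V that(3)] by (simp add: mor)
      have corep: "\<exists>(H :: ('o1, 'm, ('k, 'v) module, 'v \<Rightarrow> 'v) cfunctor) d.
          linear_functor K C (Vect K) H \<and> linear_iso K C H (C.dual_hom_functor ?N E) d"
        if "vectorspace K E" "vectorspace.fin_dim K E" for E :: "('k, 'v) module"
        by (rule linear_functor_transport[OF C.category_axioms C.Hom_vectorspace
              C.linear_dual_hom_functor[OF N that] \<iota>])
      have "\<exists>p. p \<in> module_hom K (on_obj G ?N) (on_obj F V) \<and>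
          (\<forall>x \<in> carrier (on_obj F V). p (\<eta> F V x) = x)"
      proof -
        let ?E = "on_obj F V"
        have E: "vectorspace K ?E" "vectorspace.fin_dim K ?E"
          using Vect_functor_obj[OF linF V] by auto
        obtain H :: "('o1, 'm, ('k, 'v) module, 'v \<Rightarrow> 'v) cfunctor" and d
          where H: "linear_functor K C (Vect K) H"
            and d: "linear_iso K C H (C.dual_hom_functor ?N ?E) d"
          using corep[OF E] by blast
        have HO: "H \<in> Obj AC" using H by simp
        \<comment> \<open>\<alpha> corresponds over \<open>B\<close> to the identity of
          \<open>F V\<close>. Factoring it through the unit yields \<beta> on all of
          \<open>G\<close>.\<close>
        obtain \<alpha> where \<alpha>: "\<alpha> \<in> carrier (Hom PB F (comp_functor H j))"
          and \<alpha>_eq: "\<And>X x. X \<in> Obj B \<Longrightarrow> x \<in> carrier (on_obj F X) \<Longrightarrow>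
            d (on_obj j X) (\<alpha> X x) = (\<lambda>g \<in> carrier (Hom B X V). on_mor F X V g x)"
          using B.coyoneda[OF V linear_comp_functor[OF H] dual_hom_functor_restrict[OF V d] E(1) linF
              module_hom_id] by metis
        have "\<alpha> \<in> carrier (Hom PB F (on_obj (precomp B j) H))"
          using \<alpha> by (simp only: precomp_simps)
        from adj.unit_factor[OF F HO this] obtain \<beta> where \<beta>: "\<beta> \<in> carrier (Hom AC G H)"
          and eq: "Comp PB F (comp_functor G j) (comp_functor H j) (\<lambda>X \<in> Obj B. \<beta> (on_obj j X)) (\<eta> F) = \<alpha>"
          unfolding precomp_simps G_def by blast
        have d_hom: "d ?N \<in> module_hom K (on_obj H ?N) (lin_maps K (Hom C ?N ?N) ?E)"
          using d N unfolding linear_iso_def C.dual_hom_functor_simps by blast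
        have "(\<lambda>\<phi>. \<phi> (Ident C ?N)) \<in> module_hom K (lin_maps K (Hom C ?N ?N) ?E) ?E"
          using C.ident[OF N] by (auto simp: module_hom_def)
        \<comment> \<open>\<open>p\<close> reads off the linear map belonging to \<beta>: apply
          \<beta> at \<open>?N\<close> and evaluate the resulting functional at the identity. Since
          \<beta> after the unit is \<alpha>, \<open>p\<close> undoes the unit component.\<close>
        then have p: "(\<lambda>m. d ?N (\<beta> ?N m) (Ident C ?N)) \<in> module_hom K (on_obj G ?N) ?E"
          by (rule module_hom_comp[OF module_hom_comp[OF Vect_nat_transf_hom[OF \<beta> N] d_hom]])
        have "d ?N (\<beta> ?N (\<eta> F V x)) (Ident C ?N) = x" if x: "x \<in> carrier ?E" for x
        proof -
          have "\<beta> ?N (\<eta> F V x) = \<alpha> V x"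
            using fun_cong[OF fun_cong[OF eq, of V], of x] V x by (simp add: compose_def)
          then have "d ?N (\<beta> ?N (\<eta> F V x)) (Ident C ?N) = on_mor F V V (Ident B V) x"
            using \<alpha>_eq[OF V x] B.ident[OF V] Ident_eq[OF V] by simp
          then show ?thesis
            using Vect_functor_ident[OF linF V x] by simp
        qed
        with p show ?thesis by blast
      qed
      then obtain p where p: "p \<in> module_hom K (on_obj G ?N) (on_obj F V)"
        and p_\<eta>: "\<And>x. x \<in> carrier (on_obj F V) \<Longrightarrow> p (\<eta> F V x) = x"
        by blast
      have p_mem: "p m \<in> carrier (on_obj F V)" if "m \<in> carrier (on_obj G ?N)" for m
        by (rule module_hom_mem[OF p that])
      have \<eta>_p: "\<eta> F V (p m) = m" if m: "m \<in> carrier (on_obj G ?N)" for m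
      proof -
        let ?E = "on_obj G ?N"
        have E: "vectorspace K ?E" "vectorspace.fin_dim K ?E"
          using Vect_functor_obj[OF linG N] by auto
        obtain H :: "('o1, 'm, ('k, 'v) module, 'v \<Rightarrow> 'v) cfunctor" and d
          where H: "linear_functor K C (Vect K) H"
            and d: "linear_iso K C H (C.dual_hom_functor ?N ?E) d"
          using corep[OF E] by blast
        have HO: "H \<in> Obj AC" using H by simp
        \<comment> \<open>\<open>s\<close> belongs to the identity of \<open>G ?N\<close>, and
          \<open>t\<close> to the composite of \<open>p\<close> with the unit component. Proving
          \<open>s = t\<close> identifies these two linear maps.\<close>
        obtain s where s: "s \<in> carrier (Hom AC G H)"
          and s_eq: "\<And>X x. X \<in> Obj C \<Longrightarrow> x \<in> carrier (on_obj G X) \<Longrightarrow>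
            d X (s X x) = (\<lambda>g \<in> carrier (Hom C X ?N). on_mor G X ?N g x)"
          using C.coyoneda[OF N H d E(1) linG module_hom_id] by metis
        obtain t where t: "t \<in> carrier (Hom AC G H)"
          and t_eq: "\<And>X x. X \<in> Obj C \<Longrightarrow> x \<in> carrier (on_obj G X) \<Longrightarrow>
            d X (t X x) = (\<lambda>g \<in> carrier (Hom C X ?N). \<eta> F V (p (on_mor G X ?N g x)))"
          using C.coyoneda[OF N H d E(1) linG module_hom_comp[OF p \<eta>_hom]] by metis
        have d_inj: "inj_on (d X) (carrier (on_obj H X))" if "X \<in> Obj C" for X
          using d that unfolding linear_iso_def bij_betw_def by blast
        \<comment> \<open>On the image of the unit, naturality carries the argument of
          \<open>p\<close> into the image of \<open>\<eta> F V\<close>, where \<open>p\<close>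
          followed by \<open>\<eta> F V\<close> is the identity.\<close>
        have agree: "s (on_obj j X) (\<eta> F X x) = t (on_obj j X) (\<eta> F X x)"
          if X: "X \<in> Obj B" and x: "x \<in> carrier (on_obj F X)" for X x
        proof (rule inj_onD[OF d_inj[OF obj[OF X]]])
          show "d (on_obj j X) (s (on_obj j X) (\<eta> F X x)) = d (on_obj j X) (t (on_obj j X) (\<eta> F X x))"
            unfolding s_eq[OF obj[OF X] \<eta>_mem[OF X x]] t_eq[OF obj[OF X] \<eta>_mem[OF X x]]
          proof (rule restrict_ext)
            fix g assume "g \<in> carrier (Hom C (on_obj j X) ?N)"
            then have g: "g \<in> carrier (Hom B X V)"
              by (simp add: Hom_eq X V)
            show "on_mor G (on_obj j X) ?N g (\<eta> F X x) = \<eta> F V (p (on_mor G (on_obj j X) ?N g (\<eta> F X x)))"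
              unfolding \<eta>_natural[OF X x g] p_\<eta>[OF Vect_functor_mem[OF linF X V g x]] ..
          qed
          show "s (on_obj j X) (\<eta> F X x) \<in> carrier (on_obj H (on_obj j X))"
            "t (on_obj j X) (\<eta> F X x) \<in> carrier (on_obj H (on_obj j X))"
            using Vect_nat_transf_mem[OF s obj[OF X] \<eta>_mem[OF X x]]
              Vect_nat_transf_mem[OF t obj[OF X] \<eta>_mem[OF X x]] by auto
        qed
        have "s = t"
        proof (rule adj.unit_cancel[OF F HO])
          show "s \<in> carrier (Hom AC (on_obj L F) H)" "t \<in> carrier (Hom AC (on_obj L F) H)"
            using s t unfolding G_def by auto
          show "Comp PB F (on_obj (precomp B j) (on_obj L F)) (on_obj (precomp B j) H)
              (on_mor (precomp B j) (on_obj L F) H s) (\<eta> F) =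
            Comp PB F (on_obj (precomp B j) (on_obj L F)) (on_obj (precomp B j) H)
              (on_mor (precomp B j) (on_obj L F) H t) (\<eta> F)"
            unfolding precomp_simps functor_cat_simps Vect_simps
            by (auto intro!: restrict_ext simp: compose_def agree)
        qed
        \<comment> \<open>At the identity of \<open>?N\<close> the left side is \<open>m\<close> and
          the right side is \<open>\<eta> F V (p m)\<close>.\<close>
        then have "d ?N (s ?N m) (Ident C ?N) = d ?N (t ?N m) (Ident C ?N)"
          by simp
        then show ?thesis
          unfolding s_eq[OF N m] t_eq[OF N m]
          using C.ident[OF N] Vect_functor_ident[OF linG N m] by simp
      qed
      show ?thesis
        by (rule bij_betw_byWitness[of _ p]) (auto simp: p_\<eta> \<eta>_p p_mem \<eta>_mem[OF V])
    qed
    then have "is_iso (Vect K) (on_obj F V) (on_obj (comp_functor G j) V) (\<eta> F V)"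
      if V: "V \<in> Obj B" for V
      using Vect_functor_obj(1)[OF linGj V] Vect_functor_obj(1)[OF linF V] V
        Vect_nat_transf_mor[OF \<eta>F V]
      by (intro is_iso_Vect) simp_all
    then show ?thesis
      using is_iso_functor_cat[OF category_Vect linF linGj \<eta>F] unfolding G_def by blast
  qed
  then show ?thesis
    unfolding nat_iso_def using adj.\<eta>_nat by (simp add: precomp_simps)
qed

end

section \<open>Representations of the symmetric group\<close>

text \<open>With projections in place of tuple patterns, the definitions unfold for a representation
  given by a single variable.\<close>

lemma Rep_simps:
  "X \<in> Obj (Rep K n) \<longleftrightarrow> vectorspace K (fst X) \<and> vectorspace.fin_dim K (fst X) \<and>
    group_action (sym_group n) (carrier (fst X)) (snd X) \<and>
    (\<forall>\<sigma> \<in> carrier (sym_group n). snd X \<sigma> \<in> module_hom K (fst X) (fst X))"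
  "Hom (Rep K n) X Y = (lin_maps K (fst X) (fst Y))\<lparr>carrier :=
    {f \<in> carrier (lin_maps K (fst X) (fst Y)). \<forall>\<sigma> \<in> carrier (sym_group n).
      \<forall>x \<in> carrier (fst X). f (snd X \<sigma> x) = snd Y \<sigma> (f x)}\<rparr>"
  "Ident (Rep K n) X = (\<lambda>x \<in> carrier (fst X). x)"
  "Comp (Rep K n) X Y Z g f = compose (carrier (fst X)) g f"
  by (auto simp: Rep_def split: prod.splits)

text \<open>The category laws are those of \<open>Vect K\<close>. The equivariant maps form a
  subspace of all linear maps, so their vector space structure and finite dimension are inherited
  from \<open>lin_maps\<close>.\<close>

lemma linear_category_Rep:
  "linear_category K (Rep K n :: ('k, ('k, 'v) rep, 'v \<Rightarrow> 'v) lin_cat)"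
proof -
  let ?R = "Rep K n :: ('k, ('k, 'v) rep, 'v \<Rightarrow> 'v) lin_cat"
  note V = category_Vect[of K]
  have Hom_carrier: "f \<in> carrier (Hom ?R X Y) \<longleftrightarrow>
      f \<in> carrier (Hom (Vect K) (fst X) (fst Y)) \<and>
      (\<forall>\<sigma> \<in> carrier (sym_group n). \<forall>x \<in> carrier (fst X). f (snd X \<sigma> x) = snd Y \<sigma> (f x))" for f X Y
    by (simp add: Rep_simps)
  have mem: "f x \<in> carrier (fst Y)" if "f \<in> carrier (Hom ?R X Y)" "x \<in> carrier (fst X)" for f x X Y
    using that module_hom_mem[of f K "fst X" "fst Y" x] by (simp add: Rep_simps)
  have act: "snd X \<sigma> x \<in> carrier (fst X)"
    if "X \<in> Obj ?R" "\<sigma> \<in> carrier (sym_group n)" "x \<in> carrier (fst X)" for X \<sigma> x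
    using that module_hom_mem[of "snd X \<sigma>" K "fst X" "fst X" x] by (simp add: Rep_simps)
  have act_hom: "snd X \<sigma> \<in> module_hom K (fst X) (fst X)"
    if "X \<in> Obj ?R" "\<sigma> \<in> carrier (sym_group n)" for X \<sigma>
    using that by (simp add: Rep_simps)
  have Obj_Vect: "fst X \<in> Obj (Vect K)" if "X \<in> Obj ?R" for X
    using that by (simp add: Rep_simps)
  have Comp_Vect: "Comp ?R X Y Z g f = Comp (Vect K) (fst X) (fst Y) (fst Z) g f" for X Y Z g f
    by (simp add: Rep_simps)
  have Ident_Vect: "Ident ?R X = Ident (Vect K) (fst X)" for X
    by (simp add: Rep_simps)
  have comp: "Comp ?R X Y Z g f \<in> carrier (Hom ?R X Z)"
    if XYZ: "X \<in> Obj ?R" "Y \<in> Obj ?R" "Z \<in> Obj ?R"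
      and f: "f \<in> carrier (Hom ?R X Y)" and g: "g \<in> carrier (Hom ?R Y Z)" for X Y Z f g
  proof -
    have "Comp (Vect K) (fst X) (fst Y) (fst Z) g f \<in> carrier (Hom (Vect K) (fst X) (fst Z))"
      using f g unfolding Hom_carrier by (intro category.comp[OF V] Obj_Vect XYZ) auto
    moreover have "g (f (snd X \<sigma> x)) = snd Z \<sigma> (g (f x))"
      if "\<sigma> \<in> carrier (sym_group n)" "x \<in> carrier (fst X)" for \<sigma> x
      using f g that mem[OF f that(2)] unfolding Hom_carrier by simp
    ultimately show ?thesis
      unfolding Hom_carrier Comp_Vect by (simp add: compose_def act[OF XYZ(1)])
  qed
  have category: "category ?R"
  proof
    fix X assume X: "X \<in> Obj ?R"
    show "Ident ?R X \<in> carrier (Hom ?R X X)"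
      using category.ident[OF V Obj_Vect[OF X]] act[OF X] unfolding Hom_carrier Ident_Vect by simp
  next
    fix X Y Z f g
    assume "X \<in> Obj ?R" "Y \<in> Obj ?R" "Z \<in> Obj ?R"
      "f \<in> carrier (Hom ?R X Y)" "g \<in> carrier (Hom ?R Y Z)"
    then show "Comp ?R X Y Z g f \<in> carrier (Hom ?R X Z)"
      by (rule comp)
  next
    fix X Y f
    assume *: "X \<in> Obj ?R" "Y \<in> Obj ?R" "f \<in> carrier (Hom ?R X Y)"
    show "Comp ?R X X Y f (Ident ?R X) = f"
      "Comp ?R X Y Y (Ident ?R Y) f = f"
      using category.comp_ident[OF V Obj_Vect[OF *(1)] Obj_Vect[OF *(2)]]
        category.ident_comp[OF V Obj_Vect[OF *(1)] Obj_Vect[OF *(2)]] *(3)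
      unfolding Hom_carrier Comp_Vect Ident_Vect by blast+
  next
    fix X Y Z W f g h
    assume *: "X \<in> Obj ?R" "Y \<in> Obj ?R" "Z \<in> Obj ?R" "W \<in> Obj ?R"
      "f \<in> carrier (Hom ?R X Y)" "g \<in> carrier (Hom ?R Y Z)"
      "h \<in> carrier (Hom ?R Z W)"
    then show "Comp ?R X Z W h (Comp ?R X Y Z g f) =
        Comp ?R X Y W (Comp ?R Y Z W h g) f"
      unfolding Hom_carrier Comp_Vect
      by (intro category.comp_assoc[OF V] Obj_Vect) auto
  qed
  have submod: "submodule K (carrier (Hom ?R X Y)) (lin_maps K (fst X) (fst Y))"
    and vs: "vectorspace K (lin_maps K (fst X) (fst Y))"
    and fd: "vectorspace.fin_dim K (lin_maps K (fst X) (fst Y))"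
    if X: "X \<in> Obj ?R" and Y: "Y \<in> Obj ?R" for X Y
  proof -
    have XV: "vectorspace K (fst X)" "vectorspace.fin_dim K (fst X)"
      and YV: "vectorspace K (fst Y)" "vectorspace.fin_dim K (fst Y)"
      using X Y by (simp_all add: Rep_simps)
    show vs: "vectorspace K (lin_maps K (fst X) (fst Y))"
      by (rule vectorspace_lin_maps[OF XV(1) YV(1)])
    show "vectorspace.fin_dim K (lin_maps K (fst X) (fst Y))"
      by (rule fin_dim_lin_maps[OF XV YV])
    interpret L: vectorspace K "lin_maps K (fst X) (fst Y)"
      by (rule vs)
    have mod: "module K (lin_maps K (fst X) (fst Y))"
      by (rule L.module_axioms)
    \<comment> \<open>The zero map is equivariant because every group element, acting linearly,
      fixes zero.\<close>
    have zero: "snd Y \<sigma> \<zero>\<^bsub>fst Y\<^esub> = \<zero>\<^bsub>fst Y\<^esub>" if "\<sigma> \<in> carrier (sym_group n)" for \<sigma>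
    proof -
      interpret f: linear_map K "fst Y" "fst Y" "snd Y \<sigma>"
        by (rule linear_mapI[OF YV(1) YV(1) act_hom[OF Y that]])
      show ?thesis by (rule f.f0_is_0)
    qed
    show "submodule K (carrier (Hom ?R X Y)) (lin_maps K (fst X) (fst Y))"
    proof (rule submodule.intro[OF mod])
      show "carrier (Hom ?R X Y) \<subseteq> carrier (lin_maps K (fst X) (fst Y))"
        by (auto simp: Rep_simps)
    next
      fix f g assume f: "f \<in> carrier (Hom ?R X Y)" and g: "g \<in> carrier (Hom ?R X Y)"
      then have "f \<oplus>\<^bsub>lin_maps K (fst X) (fst Y)\<^esub> g \<in> carrier (lin_maps K (fst X) (fst Y))"
        unfolding Hom_carrier Vect_simps by (intro L.M.add.m_closed) auto
      then show "f \<oplus>\<^bsub>lin_maps K (fst X) (fst Y)\<^esub> g \<in> carrier (Hom ?R X Y)"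
        using f g unfolding Hom_carrier Vect_simps
        by (simp add: act[OF X] module_hom_add[OF act_hom[OF Y]] mem[OF f] mem[OF g])
    next
      show "\<zero>\<^bsub>lin_maps K (fst X) (fst Y)\<^esub> \<in> carrier (Hom ?R X Y)"
        using L.M.zero_closed unfolding Hom_carrier Vect_simps
        by (simp add: act[OF X] zero)
    next
      fix a f assume a: "a \<in> carrier K" and f: "f \<in> carrier (Hom ?R X Y)"
      then have "a \<odot>\<^bsub>lin_maps K (fst X) (fst Y)\<^esub> f \<in> carrier (lin_maps K (fst X) (fst Y))"
        unfolding Hom_carrier Vect_simps by (intro L.smult_closed) auto
      then show "a \<odot>\<^bsub>lin_maps K (fst X) (fst Y)\<^esub> f \<in> carrier (Hom ?R X Y)"
        using a f unfolding Hom_carrier Vect_simps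
        by (simp add: act[OF X] module_hom_smult[OF act_hom[OF Y]] mem[OF f])
    qed
  qed
  have Hom_eq: "Hom ?R X Y =
      (lin_maps K (fst X) (fst Y))\<lparr>carrier := carrier (Hom ?R X Y)\<rparr>" for X Y
    by (simp add: Rep_simps)
  show ?thesis
  proof (intro linear_category.intro category linear_category_axioms.intro)
    fix X Y assume XY: "X \<in> Obj ?R" "Y \<in> Obj ?R"
    show "vectorspace K (Hom ?R X Y)" "vectorspace.fin_dim K (Hom ?R X Y)"
      using subspace_vectorspace[OF vs[OF XY] submod[OF XY]]
        subspace_fin_dim[OF vs[OF XY] fd[OF XY] submod[OF XY]] Hom_eq[of X Y] by simp_all
  next
    fix X Y Z f
    assume *: "X \<in> Obj ?R" "Y \<in> Obj ?R" "Z \<in> Obj ?R"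
      and f: "f \<in> carrier (Hom ?R X Y)"
    have "Comp ?R X Y Z (g \<oplus>\<^bsub>Hom ?R Y Z\<^esub> h) f =
        Comp ?R X Y Z g f \<oplus>\<^bsub>Hom ?R X Z\<^esub> Comp ?R X Y Z h f" for g h
      unfolding Rep_simps by (auto simp: compose_def mem[OF f] intro!: restrict_ext)
    moreover have "Comp ?R X Y Z (a \<odot>\<^bsub>Hom ?R Y Z\<^esub> g) f =
        a \<odot>\<^bsub>Hom ?R X Z\<^esub> Comp ?R X Y Z g f" for a g
      unfolding Rep_simps by (auto simp: compose_def mem[OF f] intro!: restrict_ext)
    ultimately show "(\<lambda>g. Comp ?R X Y Z g f) \<in> module_hom K (Hom ?R Y Z) (Hom ?R X Z)"
      unfolding module_hom_def using comp[OF * f] by simp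
  next
    fix X Y Z g
    assume *: "X \<in> Obj ?R" "Y \<in> Obj ?R" "Z \<in> Obj ?R"
      and g: "g \<in> carrier (Hom ?R Y Z)"
    have g_hom: "g \<in> module_hom K (fst Y) (fst Z)"
      using g unfolding Hom_carrier by simp
    have "Comp ?R X Y Z g (f \<oplus>\<^bsub>Hom ?R X Y\<^esub> h) =
        Comp ?R X Y Z g f \<oplus>\<^bsub>Hom ?R X Z\<^esub> Comp ?R X Y Z g h"
      if "f \<in> carrier (Hom ?R X Y)" "h \<in> carrier (Hom ?R X Y)" for f h
      using mem[OF that(1)] mem[OF that(2)] unfolding Rep_simps
      by (auto simp: compose_def module_hom_add[OF g_hom] intro!: restrict_ext)
    moreover have "Comp ?R X Y Z g (a \<odot>\<^bsub>Hom ?R X Y\<^esub> f) =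
        a \<odot>\<^bsub>Hom ?R X Z\<^esub> Comp ?R X Y Z g f"
      if "a \<in> carrier K" "f \<in> carrier (Hom ?R X Y)" for a f
      using mem[OF that(2)] that(1) unfolding Rep_simps
      by (auto simp: compose_def module_hom_smult[OF g_hom] intro!: restrict_ext)
    ultimately show "(\<lambda>f. Comp ?R X Y Z g f) \<in> module_hom K (Hom ?R X Y) (Hom ?R X Z)"
      unfolding module_hom_def using comp[OF * _ g] by simp
  qed
qed

theorem proposition3p2p7:
  fixes K :: "'k ring" and n :: nat
    and T :: "('k, 'v) module \<Rightarrow> ('k, 'v) rep"
    and \<tau> :: "('k, 'v) module \<Rightarrow> (nat \<Rightarrow> 'v) \<Rightarrow> 'v"
    and \<iota> :: "'k list \<Rightarrow> 'v"
  assumes "field K"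
    and positive_char: "\<exists>p::nat. p > 0 \<and> [p] \<cdot>\<^bsub>K\<^esub> \<one>\<^bsub>K\<^esub> = \<zero>\<^bsub>K\<^esub>"
    and "n > 0"
    and universe: "inj_on \<iota> (lists (carrier K))"
    and tensor: "\<And>V. V \<in> Obj (Vect K) \<Longrightarrow> tensor_power K n V (T V) (\<tau> V)"
  shows
    "(\<forall>j_shriek \<eta> \<epsilon>.
        adjunction (P_cat K n T) (A_cat K n) j_shriek (j_pullback K n T) \<eta> \<epsilon> \<longrightarrow>
        nat_iso (P_cat K n T) (P_cat K n T)
          id_functor (comp_functor (j_pullback K n T) j_shriek) \<eta>) \<and>
     (\<forall>j_star \<eta> \<epsilon>.
        adjunction (A_cat K n) (P_cat K n T) (j_pullback K n T) j_star \<eta> \<epsilon> \<longrightarrow>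
        nat_iso (P_cat K n T) (P_cat K n T)
          (comp_functor (j_pullback K n T) j_star) id_functor \<epsilon>)"
proof -
  \<comment> \<open>Morphisms of \<open>Gamma K n T\<close> are by definition equivariant maps
    between the chosen tensor powers, and \<open>tensor\<close> makes each \<open>T V\<close> an
    object of \<open>Rep K n\<close>. Membership in \<open>Obj (Vect K)\<close> is kept folded to
    match the premise of \<open>tensor\<close>.\<close>
  have "full_embedding K (Rep K n) (Gamma K n T) (tensor_functor T)"
    using tensor linear_category_Rep[of K n]
    unfolding full_embedding_def full_embedding_axioms_def
    by (simp add: Gamma_def tensor_functor_def tensor_power_def del: Vect_simps)
  then show ?thesis
    unfolding j_pullback_def
    using full_embedding.unit_iso[OF _ _ universe] full_embedding.counit_iso[OF _ _ universe]
    by blast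
qed

end
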